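(* Let $\beta\in\mathbb{R}\setminus\{0\}$ and let $X^\beta$ be the vector field on $\mathbb{R}^3$ given by $X^\beta(x,y,z)=(yz+\beta y)\partial_x+(xz-\beta x)\partial_y-xy\,\partial_z$. Let $M\in\mathbb{R}$ and $\Sigma^\beta_{-\beta M}:=\{(x,y,z)\in\mathbb{R}^3:\tfrac14(-x^2+y^2)-\beta z=-\beta M\}$, which contains the equilibrium $(0,0,M)$ and to which $X^\beta$ is tangent. Then: (a) the characteristic polynomial of the linearization of $X^\beta|_{\Sigma^\beta_{-\beta M}}$ at $(0,0,M)$ is $\mu^2+(\beta^2-M^2)$; (b) if $|\beta|<|M|$, $(0,0,M)$ is an unstable equilibrium of $X^\beta|_{\Sigma^\beta_{-\beta M}}$; (c) if $|\beta|>|M|$, $(0,0,M)$ is a Lyapunov stable equilibrium of $X^\beta|_{\Sigma^\beta_{-\beta M}}$; (d) if $|\beta|>|M|$, there exist $\widetilde{\varepsilon_0}>0$ and a one-parameter family $\{\widetilde{\gamma_\varepsilon}\}_{0<\varepsilon\le\widetilde{\varepsilon_0}}\subset\Sigma^\beta_{-\beta M}$ of periodic orbits of $X^\beta|_{\Sigma^\beta_{-\beta M}}$ (hence of $X^\beta$) shrinking to $(0,0,M)$ as $\varepsilon\to0$, with periods $T_\varepsilon\to2\pi/\sqrt{\beta^2-M^2}$ as $\varepsilon\to0$; moreover $\{(0,0,M)\}\cup\bigcup_{0<\varepsilon<\widetilde{\varepsilon_0}}\widetilde{\gamma_\varepsilon}$ is the connected component of $\Sigma^\beta_{-\beta M}\setminus\widetilde{\gamma_{\widetilde{\varepsilon_0}}}$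 containing $(0,0,M)$.
   Context: The linearization of a vector field $Y$ at an equilibrium $m$ (here of the restricted field on the surface $\Sigma^\beta_{-\beta M}$) is the linear endomorphism $v\mapsto\frac{\mathrm{d}}{\mathrm{d}t}(\mathrm{D}F^Y_t(m)v)|_{t=0}$ of the tangent space at $m$, $F^Y_t$ the flow. *)

theory Defs
  imports "HOL-Analysis.Analysis" "HOL-Computational_Algebra.Polynomial"
begin

definition Xb :: "real \<Rightarrow> real^3 \<Rightarrow> real^3" where
  "Xb \<beta> p = vector [p$2 * p$3 + \<beta> * p$2, p$1 * p$3 - \<beta> * p$1, - (p$1 * p$2)]"

definition Sig :: "real \<Rightarrow> real \<Rightarrow> (real^3) set" where
  "Sig \<beta> c = {p. (- (p$1 * p$1) + p$2 * p$2) / 4 - \<beta> * p$3 = c}"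

text \<open>The flow of a (globally integrable) vector field: F_t(x) is the value at time t of
  the unique solution defined on all of R with initial value x.\<close>
definition flow :: "('a::real_normed_vector \<Rightarrow> 'a) \<Rightarrow> real \<Rightarrow> 'a \<Rightarrow> 'a" where
  "flow X t x = (THE \<phi>. \<phi> 0 = x \<and> (\<forall>s. (\<phi> has_vector_derivative X (\<phi> s)) (at s))) t"

definition tangent_space :: "'a::real_normed_vector set \<Rightarrow> 'a \<Rightarrow> 'a set" where
  "tangent_space S m = {v. \<exists>c. c 0 = m \<and> (\<forall>t. c t \<in> S) \<and> (c has_vector_derivative v) (at 0)}"

definition linearization :: "('a::real_normed_vector \<Rightarrow> 'a) \<Rightarrow> 'a \<Rightarrow> 'a \<Rightarrow> 'a" where
  "linearization X m v = vector_derivative (\<lambda>t. frechet_derivative (flow X t) (at m) v) (at 0)"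

text \<open>Characteristic polynomial det(mu I - A) of an endomorphism L of a finite-dimensional
  subspace V, computed from the matrix A of L in a basis b 0, ..., b (n-1) of V.\<close>
definition charpoly_on :: "'a::real_vector set \<Rightarrow> ('a \<Rightarrow> 'a) \<Rightarrow> real poly" where
  "charpoly_on V L = (SOME q. \<exists>(b::nat \<Rightarrow> 'a) (A::nat \<Rightarrow> nat \<Rightarrow> real).
      inj_on b {..<dim V} \<and> independent (b ` {..<dim V}) \<and> span (b ` {..<dim V}) = V \<and>
      (\<forall>j<dim V. L (b j) = (\<Sum>i<dim V. A i j *\<^sub>R b i)) \<and>
      q = (\<Sum>p | p permutes {..<dim V}. of_int (sign p) *
             (\<Prod>i<dim V. (if i = p i then [:0, 1:] else 0) - [:A i (p i):])))"

definition lyapunov_stable_on :: "('a::real_normed_vector \<Rightarrow> 'a) \<Rightarrow> 'a set \<Rightarrow> 'a \<Rightarrow> bool" where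
  "lyapunov_stable_on X S m \<longleftrightarrow> X m = 0 \<and> m \<in> S \<and>
     (\<forall>e>0. \<exists>d>0. \<forall>x\<in>S. dist x m < d \<longrightarrow> (\<forall>t\<ge>0. dist (flow X t x) m < e))"

definition unstable_on :: "('a::real_normed_vector \<Rightarrow> 'a) \<Rightarrow> 'a set \<Rightarrow> 'a \<Rightarrow> bool" where
  "unstable_on X S m \<longleftrightarrow> X m = 0 \<and> m \<in> S \<and> \<not> lyapunov_stable_on X S m"

definition periodic_orbit :: "('a::real_normed_vector \<Rightarrow> 'a) \<Rightarrow> 'a set \<Rightarrow> real \<Rightarrow> bool" where
  "periodic_orbit X \<gamma> T \<longleftrightarrow> (\<exists>p. \<gamma> = range (\<lambda>t. flow X t p) \<and> 0 < T \<and> flow X T p = p \<and>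
      (\<forall>s\<in>{0<..<T}. flow X s p \<noteq> p))"

end

theory Submission
  imports Defs
begin

text \<open>
  Besides the function defining the surface, \<open>x^2 + y^2 + 2 z^2\<close> is conserved, so the flow is
  complete. Combining both integrals gives \<open>V = a x^2 + b y^2 + 2 (z - M)^2\<close> with
  \<open>a = 1 - M / \<beta>\<close> and \<open>b = 1 + M / \<beta>\<close>, which is positive definite for \<open>|M| < |\<beta>|\<close> and yields
  stability. On the surface, which is a graph over the \<open>(x, y)\<close>-plane, the polar angle of
  \<open>(sqrt a * x, sqrt b * y)\<close> moves with speed \<open>- \<beta> * sqrt (a * b) * (1 + g)\<close>, where
  \<open>0 \<le> g \<le> C * V\<close>, and \<open>V\<close> increases strictly along rays. Hence the level curves of \<open>V\<close> are
  periodic orbits with periods tending to \<open>2 pi / (|\<beta>| sqrt (a b))\<close>, and their interiors are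
  the sublevel sets of \<open>V\<close>. For \<open>|\<beta>| < |M|\<close> the function \<open>sgn M * x * y\<close> grows near the
  equilibrium. The derivative of the flow at the equilibrium is found by Gronwall's inequality.
\<close>

section \<open>Global solutions of Lipschitz differential equations\<close>

text \<open>\<open>flow\<close> is a definite description over solutions defined on the whole real
  line, so nothing can be said about it before global existence and uniqueness are proved. The
  conserved ellipsoids supply both: they keep each orbit in a ball, on which the quadratic field is
  Lipschitz. For the periodic orbits, level and polar angle serve as coordinates on the surface. An
  orbit keeps its level, while its angle is strictly monotone and unbounded in both time directions;
  so the orbit fills the whole level curve and first returns when the angle has changed by 2 pi. The
  correction g to the angular speed comes from the height. The angular momentum of the rescaled
  orbit involves z, and substituting the graph equation splits it into a multiple of the squared
  radius and a quartic term in x and y. Quartic over squared radius is of the order of the squared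
  radius, hence at most of the order of V. This is why the angular speed tends to a constant, and
  the periods to a limit, as the level shrinks.\<close>

lemma continuous_antiderivative:
  fixes f :: "real \<Rightarrow> 'a::banach"
  assumes "continuous_on UNIV f"
  obtains F where "F 0 = 0" "\<And>t. (F has_vector_derivative f t) (at t)"
proof -
  define F where "F t = (if 0 \<le> t then integral {0..t} f else - integral {t..0} f)" for t
  have int: "f integrable_on {a..b}" for a b
    using assms continuous_on_subset integrable_continuous_interval by blast
  have "(F has_vector_derivative f t) (at t)" for t
  proof -
    define N where "N = \<bar>t\<bar> + 1"
    \<comment> \<open>Around \<open>t\<close> both branches of \<open>F\<close> are one indefinite
      integral from \<open>-N\<close> up to a constant, so differentiability at 0 needs no separate
      argument.\<close>
    have F: "F s = integral {-N..s} f - integral {-N..0} f" if "s \<in> {-N<..<N}" for s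
    proof (cases "0 \<le> s")
      case True
      then have "integral {-N..0} f + integral {0..s} f = integral {-N..s} f"
        by (intro Henstock_Kurzweil_Integration.integral_combine int) (auto simp: N_def)
      with True show ?thesis by (simp add: F_def algebra_simps)
    next
      case False
      then have "integral {-N..s} f + integral {s..0} f = integral {-N..0} f"
        using that by (intro Henstock_Kurzweil_Integration.integral_combine int) (auto simp: N_def)
      with False show ?thesis by (simp add: F_def algebra_simps)
    qed
    have "((\<lambda>s. integral {-N..s} f) has_vector_derivative f t) (at t within {-N..N})"
      by (rule integral_has_vector_derivative)
         (use assms continuous_on_subset in \<open>auto simp: N_def\<close>)
    moreover have "at t within {-N..N} = at t"
      by (rule at_within_interior) (auto simp: N_def)
    ultimately have "((\<lambda>s. integral {-N..s} f - integral {-N..0} f) has_vector_derivative f t) (at t)"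
      by (auto intro!: derivative_eq_intros)
    then show ?thesis
      by (rule has_vector_derivative_transform_within_open[where S="{-N<..<N}"])
         (auto simp: F N_def)
  qed
  then show thesis by (intro that[of F]) (auto simp: F_def)
qed

text \<open>Integrating \<open>c * exp (K * s)\<close> gains a factor \<open>1 / K\<close>; choosing
  \<open>K\<close> large against the Lipschitz constant is what turns Picard iteration into a
  contraction.\<close>

lemma exp_derivative_bound_forward:
  fixes D :: "real \<Rightarrow> 'a::real_normed_vector"
  assumes "0 \<le> t" "0 < K" "D 0 = 0"
    and d: "\<And>s. 0 \<le> s \<Longrightarrow> (D has_vector_derivative D' s) (at s)"
    and b: "\<And>s. 0 \<le> s \<Longrightarrow> norm (D' s) \<le> c * exp (K * s)"
  shows "norm (D t) \<le> c / K * exp (K * t)"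
\<comment> \<open>The mean value bound of the second case needs a nondegenerate interval.\<close>
proof (cases "t = 0")
  case True
  have "0 \<le> norm (D' 0)" by simp
  also have "\<dots> \<le> c" using b[of 0] by simp
  finally show ?thesis using True assms by simp
next
  case False
  have c: "0 \<le> c" using b[of 0] order_trans[OF norm_ge_zero[of "D' 0"]] by simp
  have "norm (D t - D 0) \<le> c / K * exp (K * t) - c / K * exp (K * 0)"
  proof (rule differentiable_bound_general[where f' = D'])
    show "continuous_on {0..t} D"
      using d by (auto intro!: continuous_at_imp_continuous_on has_vector_derivative_continuous)
    show "((\<lambda>t. c / K * exp (K * t)) has_vector_derivative c * exp (K * s)) (at s)" for s
      using \<open>0 < K\<close> unfolding has_real_derivative_iff_has_vector_derivative[symmetric]
      by (auto intro!: derivative_eq_intros)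
  qed (use False assms in \<open>auto intro!: continuous_intros\<close>)
  also have "\<dots> \<le> c / K * exp (K * t)" using c \<open>0 < K\<close> by simp
  finally show ?thesis using \<open>D 0 = 0\<close> by simp
qed

lemma has_vector_derivative_reflect:
  assumes "(g has_vector_derivative g') (at (- t))"
  shows "((\<lambda>s. g (- s)) has_vector_derivative - g') (at t)"
proof -
  have "((g \<circ> uminus) has_vector_derivative (-1) *\<^sub>R g') (at t)"
    by (rule vector_diff_chain_at) (use assms in \<open>auto intro!: derivative_eq_intros\<close>)
  then show ?thesis by (simp add: o_def)
qed

lemma exp_derivative_bound:
  fixes D :: "real \<Rightarrow> 'a::real_normed_vector"
  assumes "0 < K" "D 0 = 0"
    and d: "\<And>s. (D has_vector_derivative D' s) (at s)"
    and b: "\<And>s. norm (D' s) \<le> c * exp (K * \<bar>s\<bar>)"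
  shows "norm (D t) \<le> c / K * exp (K * \<bar>t\<bar>)"
proof (cases "0 \<le> t")
  case True
  then show ?thesis
    using exp_derivative_bound_forward[of t K D D' c] assms b by (metis abs_of_nonneg)
next
  case False
  have "norm ((\<lambda>s. D (- s)) (- t)) \<le> c / K * exp (K * - t)"
  proof (rule exp_derivative_bound_forward[where D' = "\<lambda>s. - D' (- s)"])
    show "norm (- D' (- s)) \<le> c * exp (K * s)" if "0 \<le> s" for s
      using b[of "- s"] that by simp
  qed (use False assms in \<open>auto intro!: has_vector_derivative_reflect d\<close>)
  then show ?thesis using False by simp
qed

text \<open>Picard iteration is a contraction for the exponentially weighted supremum norm; the
  weight makes a single fixed point argument work on the whole real line.\<close>
theorem global_solution_exists:
  fixes f :: "'a::euclidean_space \<Rightarrow> 'a"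
  assumes lip: "L-lipschitz_on UNIV f" and bdd: "\<And>x. norm (f x) \<le> B"
  obtains \<phi> where "\<phi> 0 = x0" "\<And>t. (\<phi> has_vector_derivative f (\<phi> t)) (at t)"
proof -
  have L: "0 \<le> L" using lip lipschitz_on_nonneg by blast
  have B: "0 \<le> B" using bdd[of 0] norm_ge_zero order_trans by blast
  \<comment> \<open>Makes the contraction factor \<open>L / K\<close> at most 1/2; the summand 1
    keeps \<open>K\<close> positive when \<open>L = 0\<close>.\<close>
  define K where "K = 2 * (L + 1)"
  have K: "0 < K" "L / K \<le> 1 / 2" using L by (auto simp: K_def field_simps)
  define J where "J u = (SOME F. F 0 = 0 \<and> (\<forall>t. (F has_vector_derivative u t) (at t)))"
    for u :: "real \<Rightarrow> 'a"
  have J: "J u 0 = 0" "(J u has_vector_derivative u t) (at t)"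
    if "continuous_on UNIV u" for u t
  proof -
    have "\<exists>F. F 0 = 0 \<and> (\<forall>t. (F has_vector_derivative u t) (at t))"
      using continuous_antiderivative[OF that] by blast
    from someI_ex[OF this] show "J u 0 = 0" "(J u has_vector_derivative u t) (at t)"
      unfolding J_def by auto
  qed
  \<comment> \<open>A candidate solution is stored with its weight, as the bounded function
    \<open>u s = exp (- (K * \<bar>s\<bar>)) *\<^sub>R \<phi> s\<close>; \<open>h u\<close> removes
    the weight before applying \<open>f\<close>, and \<open>G\<close> below restores it after
    integrating.\<close>
  define h where "h u s = f (exp (K * \<bar>s\<bar>) *\<^sub>R apply_bcontfun u s)" for u and s :: real
  have fcont: "continuous_on UNIV f" using lip by (rule lipschitz_on_continuous_on)
  have hcont: "continuous_on UNIV (h u)" for u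
    unfolding h_def
    by (rule continuous_on_compose2[OF fcont]) (auto intro!: continuous_intros)
  define G where "G u t = exp (- (K * \<bar>t\<bar>)) *\<^sub>R (x0 + J (h u) t)" for u t
  have Jbound: "norm (J (h u) t) \<le> B / K * exp (K * \<bar>t\<bar>)" for u t
  proof (rule exp_derivative_bound[OF K(1) J[OF hcont]])
    fix s
    have "norm (h u s) \<le> B * 1" using bdd by (simp add: h_def)
    also have "\<dots> \<le> B * exp (K * \<bar>s\<bar>)"
      using B K by (intro mult_left_mono) auto
    finally show "norm (h u s) \<le> B * exp (K * \<bar>s\<bar>)" .
  qed
  have Gb: "G u \<in> bcontfun" for u
  proof (rule bcontfun_normI)
    have "continuous_on UNIV (J (h u))"
      using J[OF hcont]
      by (auto intro!: continuous_at_imp_continuous_on has_vector_derivative_continuous)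
    then show "continuous_on UNIV (G u)" unfolding G_def by (intro continuous_intros)
    fix t
    have "norm (G u t) \<le> exp (- (K * \<bar>t\<bar>)) * (norm x0 + norm (J (h u) t))"
      unfolding G_def by (simp add: norm_triangle_ineq)
    also have "\<dots> \<le> exp (- (K * \<bar>t\<bar>)) * (norm x0 + B / K * exp (K * \<bar>t\<bar>))"
      using Jbound by (intro mult_left_mono add_left_mono) auto
    also have "\<dots> = exp (- (K * \<bar>t\<bar>)) * norm x0 + B / K"
      by (simp add: algebra_simps exp_minus)
    also have "\<dots> \<le> norm x0 + B / K"
      using K by (simp add: mult_left_le_one_le)
    finally show "norm (G u t) \<le> norm x0 + B / K" .
  qed
  have "dist (Bcontfun (G u)) (Bcontfun (G v)) \<le> 1 / 2 * dist u v" for u v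
  proof (rule dist_bound)
    fix t
    have "norm ((\<lambda>t. J (h u) t - J (h v) t) t) \<le> (L * dist u v) / K * exp (K * \<bar>t\<bar>)"
    proof (rule exp_derivative_bound[OF K(1)])
      show "((\<lambda>t. J (h u) t - J (h v) t) has_vector_derivative h u s - h v s) (at s)" for s
        by (intro derivative_intros J hcont)
      fix s
      have "norm (h u s - h v s) \<le>
          L * norm (exp (K * \<bar>s\<bar>) *\<^sub>R apply_bcontfun u s - exp (K * \<bar>s\<bar>) *\<^sub>R apply_bcontfun v s)"
        unfolding h_def using lipschitz_on_normD[OF lip] by simp
      also have "\<dots> = L * (exp (K * \<bar>s\<bar>) * dist (apply_bcontfun u s) (apply_bcontfun v s))"
        by (simp add: dist_norm flip: scaleR_diff_right)
      also have "\<dots> \<le> L * (exp (K * \<bar>s\<bar>) * dist u v)"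
        using L dist_bounded by (intro mult_left_mono) auto
      finally show "norm (h u s - h v s) \<le> L * dist u v * exp (K * \<bar>s\<bar>)"
        by (simp add: algebra_simps)
    qed (simp add: J hcont)
    then have "exp (- (K * \<bar>t\<bar>)) * norm (J (h u) t - J (h v) t)
        \<le> exp (- (K * \<bar>t\<bar>)) * ((L * dist u v) / K * exp (K * \<bar>t\<bar>))"
      by (intro mult_left_mono) auto
    also have "\<dots> = L / K * dist u v" by (simp add: exp_minus)
    also have "\<dots> \<le> 1 / 2 * dist u v" using K by (intro mult_right_mono) auto
    finally show "dist (apply_bcontfun (Bcontfun (G u)) t) (apply_bcontfun (Bcontfun (G v)) t)
        \<le> 1 / 2 * dist u v"
      by (simp add: Bcontfun_inverse Gb dist_norm G_def flip: scaleR_diff_right)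
  qed
  then have "\<exists>!u. Bcontfun (G u) = u"
    by (intro banach_fix_type[of "1/2"]) auto
  then obtain u where "Bcontfun (G u) = u" by blast
  then have u: "apply_bcontfun u t = G u t" for t
    using Gb Bcontfun_inverse by metis
  \<comment> \<open>Without the weight, the fixed point equation is the integral equation of the
    initial value problem.\<close>
  define \<phi> where "\<phi> t = x0 + J (h u) t" for t
  have hu: "h u t = f (\<phi> t)" for t
    by (simp add: h_def[of _ t] u G_def \<phi>_def flip: exp_add)
  show thesis
  proof
    show "\<phi> 0 = x0" by (simp add: \<phi>_def J hcont)
    show "(\<phi> has_vector_derivative f (\<phi> t)) (at t)" for t
      unfolding \<phi>_def[abs_def] using J(2)[OF hcont, of u t]
      by (auto intro!: derivative_eq_intros simp: hu \<phi>_def)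
  qed
qed

text \<open>The squared norm is differentiable also where \<open>g\<close> vanishes. Its derivative
  is at most \<open>2 * L * (norm g)\<^sup>2 + 2 * c * norm g\<close>, and
  \<open>2 * c * norm g \<le> (norm g)\<^sup>2 + c\<^sup>2\<close> accounts for the extra 1 in the
  exponent.\<close>

lemma gronwall_forward:
  fixes g :: "real \<Rightarrow> 'a::real_inner"
  assumes "0 \<le> t"
    and d: "\<And>s. 0 \<le> s \<Longrightarrow> s \<le> t \<Longrightarrow> (g has_vector_derivative g' s) (at s)"
    and b: "\<And>s. 0 \<le> s \<Longrightarrow> s \<le> t \<Longrightarrow> norm (g' s) \<le> L * norm (g s) + c"
    and "0 \<le> L"
  shows "(norm (g t))\<^sup>2 \<le> exp ((2 * L + 1) * t) * ((norm (g 0))\<^sup>2 + c\<^sup>2 * t)"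
proof -
  define K where "K = 2 * L + 1"
  define h where "h s = exp (- (K * s)) * (g s \<bullet> g s) - c\<^sup>2 * s" for s
  have "h t \<le> h 0"
  proof (rule DERIV_nonpos_imp_nonincreasing[OF \<open>0 \<le> t\<close>])
    fix s assume s: "0 \<le> s" "s \<le> t"
    have ip: "((\<lambda>s. g s \<bullet> g s) has_real_derivative 2 * (g s \<bullet> g' s)) (at s)"
      using has_derivative_inner[OF d[OF s, unfolded has_vector_derivative_def] d[OF s, unfolded has_vector_derivative_def]]
      unfolding has_field_derivative_def
      by (rule has_derivative_eq_rhs) (auto simp: inner_commute algebra_simps)
    have "(h has_real_derivative exp (- (K * s)) * (2 * (g s \<bullet> g' s) - K * (g s \<bullet> g s)) - c\<^sup>2) (at s)"
      unfolding h_def[abs_def] by (auto intro!: derivative_eq_intros ip simp: algebra_simps)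
    moreover have "exp (- (K * s)) * (2 * (g s \<bullet> g' s) - K * (g s \<bullet> g s)) - c\<^sup>2 \<le> 0"
    proof -
      have "g s \<bullet> g' s \<le> norm (g s) * norm (g' s)" by (rule norm_cauchy_schwarz)
      also have "\<dots> \<le> norm (g s) * (L * norm (g s) + c)"
        using b[OF s] by (intro mult_left_mono) auto
      finally have "2 * (g s \<bullet> g' s) - K * (g s \<bullet> g s) \<le> 2 * norm (g s) * c - (norm (g s))\<^sup>2"
        by (simp add: K_def algebra_simps power2_eq_square dot_square_norm)
      also have "\<dots> \<le> c\<^sup>2"
        using zero_le_power2[of "norm (g s) - c"] by (simp add: power2_diff)
      finally have "exp (- (K * s)) * (2 * (g s \<bullet> g' s) - K * (g s \<bullet> g s)) \<le> exp (- (K * s)) * c\<^sup>2"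
        by (intro mult_left_mono) auto
      also have "\<dots> \<le> c\<^sup>2"
        using s \<open>0 \<le> L\<close> by (intro mult_left_le_one_le) (auto simp: K_def)
      finally show ?thesis by simp
    qed
    ultimately show "\<exists>y. (h has_real_derivative y) (at s) \<and> y \<le> 0" by blast
  qed
  then have "exp (- (K * t)) * (norm (g t))\<^sup>2 \<le> (norm (g 0))\<^sup>2 + c\<^sup>2 * t"
    by (simp add: h_def power2_norm_eq_inner)
  then show ?thesis
    unfolding K_def[symmetric] by (simp add: exp_minus field_simps)
qed

lemma gronwall:
  fixes g :: "real \<Rightarrow> 'a::real_inner"
  assumes d: "\<And>s. \<bar>s\<bar> \<le> \<bar>t\<bar> \<Longrightarrow> (g has_vector_derivative g' s) (at s)"
    and b: "\<And>s. \<bar>s\<bar> \<le> \<bar>t\<bar> \<Longrightarrow> norm (g' s) \<le> L * norm (g s) + c"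
    and "0 \<le> L"
  shows "(norm (g t))\<^sup>2 \<le> exp ((2 * L + 1) * \<bar>t\<bar>) * ((norm (g 0))\<^sup>2 + c\<^sup>2 * \<bar>t\<bar>)"
proof (cases "0 \<le> t")
  case True
  then show ?thesis using gronwall_forward[of t g g' L c] assms by simp
next
  case False
  have "(norm ((\<lambda>s. g (- s)) (- t)))\<^sup>2
      \<le> exp ((2 * L + 1) * - t) * ((norm (g (- 0)))\<^sup>2 + c\<^sup>2 * - t)"
    by (rule gronwall_forward[where g' = "\<lambda>s. - g' (- s)"])
       (use False assms in \<open>auto intro!: has_vector_derivative_reflect\<close>)
  then show ?thesis using False by simp
qed

section \<open>The flow\<close>

lemma has_vector_derivative_component:
  fixes \<phi> :: "real \<Rightarrow> real^'n"
  assumes "(\<phi> has_vector_derivative D) F"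
  shows "((\<lambda>s. \<phi> s $ i) has_real_derivative D $ i) F"
proof -
  have "bounded_linear (\<lambda>v::real^'n. v $ i)" by (rule bounded_linear_vec_nth)
  from bounded_linear.has_vector_derivative[OF this assms]
  show ?thesis by (simp add: has_real_derivative_iff_has_vector_derivative)
qed

lemma has_vector_derivative_vector_3:
  assumes "(x has_real_derivative x') F" "(y has_real_derivative y') F" "(z has_real_derivative z') F"
  shows "((\<lambda>t. vector [x t, y t, z t] :: real^3) has_vector_derivative vector [x', y', z']) F"
proof -
  have eq: "vector [a, b, c] = a *\<^sub>R axis 1 1 + b *\<^sub>R axis 2 1 + c *\<^sub>R (axis 3 1 :: real^3)" for a b c
    by (simp add: vec_eq_iff forall_3 axis_def)
  show ?thesis
    unfolding eq
    by (intro has_vector_derivative_add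
        bounded_linear.has_vector_derivative[OF bounded_linear_scaleR_left]
        assms[unfolded has_real_derivative_iff_has_vector_derivative])
qed

lemma norm_3: "(norm (p::real^3))\<^sup>2 = (p$1)\<^sup>2 + (p$2)\<^sup>2 + (p$3)\<^sup>2"
  by (simp add: power2_norm_eq_inner inner_vec_def sum_3 flip: power2_eq_square)

lemma norm_le_components_3: "norm (p::real^3) \<le> \<bar>p$1\<bar> + \<bar>p$2\<bar> + \<bar>p$3\<bar>"
  using norm_le_l1_cart[of p] by (simp add: sum_3)

lemma Xb_nth [simp]:
  "Xb \<beta> p $ 1 = p$2 * p$3 + \<beta> * p$2" "Xb \<beta> p $ 2 = p$1 * p$3 - \<beta> * p$1" "Xb \<beta> p $ 3 = - (p$1 * p$2)"
  by (simp_all add: Xb_def)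

lemma Xb_equilibrium [simp]: "Xb \<beta> (vector [0, 0, M]) = 0"
  by (simp add: vec_eq_iff forall_3)

lemma mult_diff_bound:
  fixes a b c d n R :: real
  assumes "\<bar>a - c\<bar> \<le> n" "\<bar>b - d\<bar> \<le> n" "\<bar>b\<bar> \<le> R" "\<bar>c\<bar> \<le> R"
  shows "\<bar>a * b - c * d\<bar> \<le> 2 * R * n"
proof -
  have "a * b - c * d = (a - c) * b + c * (b - d)" by (simp add: algebra_simps)
  then have "\<bar>a * b - c * d\<bar> \<le> \<bar>a - c\<bar> * \<bar>b\<bar> + \<bar>c\<bar> * \<bar>b - d\<bar>"
    by (metis abs_mult abs_triangle_ineq)
  also have "\<dots> \<le> n * R + R * n"
    using assms by (intro add_mono mult_mono) auto
  finally show ?thesis by simp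
qed

text \<open>Each of the three quadratic terms contributes \<open>2 * R\<close>, each of the two
  linear terms \<bar>\<beta>\<bar>.\<close>

lemma Xb_lipschitz:
  assumes "norm p \<le> R" "norm q \<le> R"
  shows "norm (Xb \<beta> p - Xb \<beta> q) \<le> (6 * R + 2 * \<bar>\<beta>\<bar>) * norm (p - q)"
proof -
  define n where "n = norm (p - q)"
  have n: "\<bar>p$i - q$i\<bar> \<le> n" for i
    using component_le_norm_cart[of "p - q" i] by (simp add: n_def)
  have R: "\<bar>p$i\<bar> \<le> R" "\<bar>q$i\<bar> \<le> R" for i
    using component_le_norm_cart[of p i] component_le_norm_cart[of q i] assms by auto
  have m: "\<bar>p$i * p$j - q$i * q$j\<bar> \<le> 2 * R * n" for i j
    by (intro mult_diff_bound n R)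
  have l: "\<bar>\<beta> * p$i - \<beta> * q$i\<bar> \<le> \<bar>\<beta>\<bar> * n" for i
    using mult_left_mono[OF n[of i], of "\<bar>\<beta>\<bar>"] by (simp add: abs_mult flip: right_diff_distrib)
  have "norm (Xb \<beta> p - Xb \<beta> q) \<le> \<bar>(p$2 * p$3 - q$2 * q$3) + (\<beta> * p$2 - \<beta> * q$2)\<bar>
      + \<bar>(p$1 * p$3 - q$1 * q$3) - (\<beta> * p$1 - \<beta> * q$1)\<bar> + \<bar>p$1 * p$2 - q$1 * q$2\<bar>"
    using norm_le_components_3[of "Xb \<beta> p - Xb \<beta> q"] by (simp add: algebra_simps abs_minus_commute)
  also have "\<dots> \<le> (2 * R * n + \<bar>\<beta>\<bar> * n) + (2 * R * n + \<bar>\<beta>\<bar> * n) + 2 * R * n"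
    by (intro add_mono order_trans[OF abs_triangle_ineq] order_trans[OF abs_triangle_ineq4] m l)
  finally show ?thesis by (simp add: n_def algebra_simps)
qed

section \<open>Completeness and uniqueness from the conserved energy\<close>

definition energy :: "real^3 \<Rightarrow> real" where
  "energy p = (p$1)\<^sup>2 + (p$2)\<^sup>2 + 2 * (p$3)\<^sup>2"

lemma norm_le_energy: "(norm p)\<^sup>2 \<le> energy p"
  by (simp add: norm_3 energy_def)

lemma energy_le_norm: "energy p \<le> 2 * (norm p)\<^sup>2"
  by (simp add: norm_3 energy_def)

text \<open>The predicate under \<open>THE\<close> in \<open>flow\<close>, named so that existence
  and uniqueness can be stated for it.\<close>

definition sol :: "('a::real_normed_vector \<Rightarrow> 'a) \<Rightarrow> 'a \<Rightarrow> (real \<Rightarrow> 'a) \<Rightarrow> bool" where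
  "sol X x \<phi> \<longleftrightarrow> \<phi> 0 = x \<and> (\<forall>s. (\<phi> has_vector_derivative X (\<phi> s)) (at s))"

lemma constant_if_zero_derivative:
  fixes f :: "real \<Rightarrow> real"
  assumes "\<And>s. (f has_real_derivative 0) (at s)"
  shows "f t = f 0"
  using DERIV_isconst_all[of f t 0] assms by blast

text \<open>The linear and the quadratic part of \<open>Xb\<close> are separately orthogonal to the
  gradient of \<open>energy\<close>, so rescaling the argument by any factor \<open>c s\<close> does
  no harm. The factor will be that of the radial projection.\<close>

lemma energy_conserved_scaled:
  assumes "\<And>s. (\<phi> has_vector_derivative Xb \<beta> (c s *\<^sub>R \<phi> s)) (at s)"
  shows "energy (\<phi> t) = energy (\<phi> 0)"
proof (rule constant_if_zero_derivative[where f = "\<lambda>s. energy (\<phi> s)"])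
  fix s
  note d = has_vector_derivative_component[OF assms[of s]]
  show "((\<lambda>s. energy (\<phi> s)) has_real_derivative 0) (at s)"
    unfolding energy_def
    by (auto intro!: derivative_eq_intros d[of 1] d[of 2] d[of 3] simp: algebra_simps)
qed

lemma closest_point_cball_scale:
  fixes x :: "'a::euclidean_space"
  assumes "0 < R"
  obtains c where "closest_point (cball 0 R) x = c *\<^sub>R x"
proof (cases "norm x \<le> R")
  case True
  then show ?thesis using that[of 1] by (simp add: closest_point_self)
next
  case False
  then have x: "0 < norm x" "R \<le> norm x" using assms by auto
  have "(R / norm x) *\<^sub>R x = closest_point (cball 0 R) x"
  proof (rule closest_point_unique)
    show "\<forall>z\<in>cball 0 R. dist x ((R / norm x) *\<^sub>R x) \<le> dist x z"
    proof
      fix z :: 'a assume z: "z \<in> cball 0 R"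
      have "x - (R / norm x) *\<^sub>R x = (1 - R / norm x) *\<^sub>R x" by (simp add: algebra_simps)
      then have "dist x ((R / norm x) *\<^sub>R x) = \<bar>1 - R / norm x\<bar> * norm x" by (simp add: dist_norm)
      also have "\<dots> = norm x - R" using x by (simp add: field_simps)
      also have "\<dots> \<le> norm x - norm z" using z by simp
      also have "\<dots> \<le> dist x z" by (simp add: dist_norm norm_triangle_ineq2)
      finally show "dist x ((R / norm x) *\<^sub>R x) \<le> dist x z" .
    qed
  qed (use x assms in auto)
  then show ?thesis using that by metis
qed

text \<open>Composing the field with the radial projection onto a ball makes it bounded and Lipschitz
  and, the projection being radial, does not destroy conservation of the energy. The energy bound
  keeps the solution inside the ball, where nothing was changed.\<close>
lemma Xb_solution_exists: "\<exists>\<phi>. sol (Xb \<beta>) x \<phi>"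
proof -
  \<comment> \<open>The summand 1 keeps the ball nondegenerate when \<open>x\<close> is the
    origin.\<close>
  define R where "R = sqrt (energy x) + 1"
  have e0: "0 \<le> energy x" by (simp add: energy_def)
  then have R: "0 < R" "energy x \<le> R\<^sup>2"
    by (auto simp: R_def power2_eq_square algebra_simps add_pos_nonneg add_nonneg_pos)
  define Q where "Q = closest_point (cball (0::real^3) R)"
  have Q: "norm (Q p) \<le> R" for p
    using closest_point_in_set[of "cball (0::real^3) R" p] R by (simp add: Q_def)
  have "(6 * R + 2 * \<bar>\<beta>\<bar>)-lipschitz_on UNIV (\<lambda>p. Xb \<beta> (Q p))"
  proof (rule lipschitz_onI)
    fix p q
    have "dist (Xb \<beta> (Q p)) (Xb \<beta> (Q q)) \<le> (6 * R + 2 * \<bar>\<beta>\<bar>) * dist (Q p) (Q q)"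
      using Xb_lipschitz[OF Q Q] by (simp add: dist_norm)
    also have "\<dots> \<le> (6 * R + 2 * \<bar>\<beta>\<bar>) * dist p q"
      unfolding Q_def using R by (intro mult_left_mono closest_point_lipschitz) auto
    finally show "dist (Xb \<beta> (Q p)) (Xb \<beta> (Q q)) \<le> (6 * R + 2 * \<bar>\<beta>\<bar>) * dist p q" .
  qed (use R in auto)
  moreover have "norm (Xb \<beta> (Q p)) \<le> (6 * R + 2 * \<bar>\<beta>\<bar>) * R" for p
  proof -
    have "Xb \<beta> 0 = 0" by (simp add: vec_eq_iff forall_3)
    then have "norm (Xb \<beta> (Q p)) \<le> (6 * R + 2 * \<bar>\<beta>\<bar>) * norm (Q p)"
      using Xb_lipschitz[of "Q p" R 0 \<beta>] Q R by simp
    also have "\<dots> \<le> (6 * R + 2 * \<bar>\<beta>\<bar>) * R"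
      using R Q by (intro mult_left_mono) auto
    finally show ?thesis .
  qed
  ultimately obtain \<phi> where \<phi>: "\<phi> 0 = x"
    "\<And>t. (\<phi> has_vector_derivative Xb \<beta> (Q (\<phi> t))) (at t)"
    using global_solution_exists by blast
  have "\<exists>c. \<forall>p. Q p = c p *\<^sub>R p"
    unfolding Q_def using closest_point_cball_scale[OF R(1)] by metis
  then obtain c where "Q p = c p *\<^sub>R p" for p by blast
  then have E: "energy (\<phi> t) = energy x" for t
    using energy_conserved_scaled[of \<phi> \<beta> "\<lambda>s. c (\<phi> s)" t] \<phi> by simp
  have "norm (\<phi> t) \<le> R" for t
    using order_trans[OF norm_le_energy[of "\<phi> t", unfolded E] R(2)] R(1)
    by (rule power2_le_imp_le[OF _ less_imp_le])
  then have "Q (\<phi> t) = \<phi> t" for t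
    by (simp add: Q_def closest_point_self)
  then show ?thesis using \<phi> by (auto simp: sol_def)
qed

lemma sol_energy: "sol (Xb \<beta>) x \<phi> \<Longrightarrow> energy (\<phi> t) = energy x"
  using energy_conserved_scaled[of \<phi> \<beta> "\<lambda>_. 1" t] by (simp add: sol_def)

lemma sol_bounded:
  assumes "sol (Xb \<beta>) x \<phi>" "energy x \<le> R\<^sup>2" "0 \<le> R"
  shows "norm (\<phi> t) \<le> R"
  using order_trans[OF norm_le_energy[of "\<phi> t", unfolded sol_energy[OF assms(1)]] assms(2)] assms(3)
  by (rule power2_le_imp_le)

text \<open>Serves twice: \<open>x = y\<close> gives uniqueness, and a \<open>\<psi>\<close> resting
  at the equilibrium bounds the deviation of nearby orbits in the linearization. The energy
  hypotheses confine both solutions to the ball where \<open>Xb_lipschitz\<close> applies.\<close>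

lemma sol_diff_bound:
  assumes "sol (Xb \<beta>) x \<phi>" "sol (Xb \<beta>) y \<psi>" "energy x \<le> R\<^sup>2" "energy y \<le> R\<^sup>2" "0 \<le> R"
  shows "(norm (\<phi> t - \<psi> t))\<^sup>2 \<le> exp ((2 * (6 * R + 2 * \<bar>\<beta>\<bar>) + 1) * \<bar>t\<bar>) * (norm (x - y))\<^sup>2"
proof -
  have "(norm (\<phi> t - \<psi> t))\<^sup>2
      \<le> exp ((2 * (6 * R + 2 * \<bar>\<beta>\<bar>) + 1) * \<bar>t\<bar>) * ((norm (\<phi> 0 - \<psi> 0))\<^sup>2 + 0\<^sup>2 * \<bar>t\<bar>)"
  proof (rule gronwall[where g = "\<lambda>s. \<phi> s - \<psi> s"])
    show "((\<lambda>s. \<phi> s - \<psi> s) has_vector_derivative Xb \<beta> (\<phi> s) - Xb \<beta> (\<psi> s)) (at s)" for s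
      using assms by (intro derivative_intros) (auto simp: sol_def)
    show "norm (Xb \<beta> (\<phi> s) - Xb \<beta> (\<psi> s)) \<le> (6 * R + 2 * \<bar>\<beta>\<bar>) * norm (\<phi> s - \<psi> s) + 0" for s
      using Xb_lipschitz[OF sol_bounded sol_bounded] assms by simp
  qed (use assms in auto)
  then show ?thesis using assms by (simp add: sol_def)
qed

lemma Xb_solution_unique:
  assumes "sol (Xb \<beta>) x \<phi>" "sol (Xb \<beta>) x \<psi>"
  shows "\<phi> = \<psi>"
proof
  fix t
  have "0 \<le> energy x" by (simp add: energy_def)
  then have "(norm (\<phi> t - \<psi> t))\<^sup>2 \<le> 0"
    using sol_diff_bound[OF assms, of "sqrt (energy x)" t] by simp
  then show "\<phi> t = \<psi> t" by simp
qed

lemma sol_flow: "sol (Xb \<beta>) x (\<lambda>t. flow (Xb \<beta>) t x)"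
proof -
  have "\<exists>!\<phi>. sol (Xb \<beta>) x \<phi>"
    by (rule ex_ex1I[OF Xb_solution_exists]) (rule Xb_solution_unique)
  from theI'[OF this] show ?thesis
    unfolding flow_def sol_def[symmetric] .
qed

lemma flow_0 [simp]: "flow (Xb \<beta>) 0 x = x"
  using sol_flow by (auto simp: sol_def)

lemma flow_has_vector_derivative:
  "((\<lambda>t. flow (Xb \<beta>) t x) has_vector_derivative Xb \<beta> (flow (Xb \<beta>) s x)) (at s)"
  using sol_flow by (auto simp: sol_def)

lemma flow_equilibrium:
  assumes "Xb \<beta> m = 0"
  shows "flow (Xb \<beta>) t m = m"
proof -
  have "sol (Xb \<beta>) m (\<lambda>_. m)" using assms by (auto simp: sol_def)
  then show ?thesis using Xb_solution_unique[OF sol_flow] by metis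
qed

lemma flow_coordinates:
  "((\<lambda>t. flow (Xb \<beta>) t p $ 1) has_real_derivative
     flow (Xb \<beta>) s p $ 2 * (flow (Xb \<beta>) s p $ 3 + \<beta>)) (at s)"
  "((\<lambda>t. flow (Xb \<beta>) t p $ 2) has_real_derivative
     flow (Xb \<beta>) s p $ 1 * (flow (Xb \<beta>) s p $ 3 - \<beta>)) (at s)"
  "((\<lambda>t. flow (Xb \<beta>) t p $ 3) has_real_derivative
     - (flow (Xb \<beta>) s p $ 1 * flow (Xb \<beta>) s p $ 2)) (at s)"
proof -
  note d = has_vector_derivative_component[OF flow_has_vector_derivative[of \<beta> p s]]
  show "((\<lambda>t. flow (Xb \<beta>) t p $ 1) has_real_derivative
      flow (Xb \<beta>) s p $ 2 * (flow (Xb \<beta>) s p $ 3 + \<beta>)) (at s)"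
    using d[of 1] by (simp add: algebra_simps)
  show "((\<lambda>t. flow (Xb \<beta>) t p $ 2) has_real_derivative
      flow (Xb \<beta>) s p $ 1 * (flow (Xb \<beta>) s p $ 3 - \<beta>)) (at s)"
    using d[of 2] by (simp add: algebra_simps)
  show "((\<lambda>t. flow (Xb \<beta>) t p $ 3) has_real_derivative
      - (flow (Xb \<beta>) s p $ 1 * flow (Xb \<beta>) s p $ 2)) (at s)"
    using d[of 3] by simp
qed

lemma flow_Sig:
  assumes "p \<in> Sig \<beta> c"
  shows "flow (Xb \<beta>) t p \<in> Sig \<beta> c"
proof -
  define F where "F p = - (p$1 * p$1) + p$2 * p$2 - 4 * \<beta> * p$3" for p :: "real^3"
  have "F (flow (Xb \<beta>) t p) = F (flow (Xb \<beta>) 0 p)"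
  proof (rule constant_if_zero_derivative[where f = "\<lambda>s. F (flow (Xb \<beta>) s p)"])
    fix s
    show "((\<lambda>s. F (flow (Xb \<beta>) s p)) has_real_derivative 0) (at s)"
      unfolding F_def
      by (auto intro!: derivative_eq_intros flow_coordinates simp: algebra_simps)
  qed
  then show ?thesis using assms by (simp add: Sig_def F_def field_simps)
qed

section \<open>Linearization at the equilibrium\<close>

lemma has_derivative_quadratic_remainder:
  fixes f :: "'a::real_normed_vector \<Rightarrow> 'b::real_normed_vector"
  assumes "bounded_linear f'"
    and r: "\<And>h. norm h \<le> 1 \<Longrightarrow> norm (f (x + h) - f x - f' h) \<le> C * (norm h)\<^sup>2"
  shows "(f has_derivative f') (at x)"
  unfolding has_derivative_at_alt
proof (intro conjI allI impI assms(1))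
  fix e :: real assume "0 < e"
  define d where "d = min 1 (e / (\<bar>C\<bar> + 1))"
  have "norm (f y - f x - f' (y - x)) \<le> e * norm (y - x)" if y: "norm (y - x) < d" for y
  proof -
    have d: "norm (y - x) \<le> 1" "(\<bar>C\<bar> + 1) * norm (y - x) \<le> e"
      using y by (auto simp: d_def field_simps)
    have "norm (f y - f x - f' (y - x)) \<le> C * (norm (y - x))\<^sup>2"
      using r[of "y - x"] d by simp
    also have "\<dots> \<le> ((\<bar>C\<bar> + 1) * norm (y - x)) * norm (y - x)"
      unfolding power2_eq_square mult.assoc by (intro mult_right_mono) auto
    also have "\<dots> \<le> e * norm (y - x)"
      using d by (intro mult_right_mono) auto
    finally show ?thesis .
  qed
  moreover have "0 < d" using \<open>0 < e\<close> by (simp add: d_def add_nonneg_pos)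
  ultimately show "\<exists>d>0. \<forall>y. norm (y - x) < d \<longrightarrow> norm (f y - f x - f' (y - x)) \<le> e * norm (y - x)"
    by blast
qed

text \<open>A fundamental pair for u'' = k u, trigonometric, polynomial or hyperbolic according to
  the sign of \<open>k\<close>. With it the linearized flow has one formula for all relations
  between \<beta> and \<open>M\<close>.\<close>

lemma cosh_sinh_like_pair:
  fixes k :: real
  obtains c s :: "real \<Rightarrow> real" where "c 0 = 1" "s 0 = 0"
    "\<And>t. (c has_real_derivative k * s t) (at t)" "\<And>t. (s has_real_derivative c t) (at t)"
proof (cases k "0 :: real" rule: linorder_cases)
  case less
  define w where "w = sqrt (- k)"
  have w: "w \<noteq> 0" "k = - w * w" using less by (auto simp: w_def)
  show ?thesis
    by (rule that[of "\<lambda>t. cos (w * t)" "\<lambda>t. sin (w * t) / w"])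
       (use w in \<open>auto intro!: derivative_eq_intros\<close>)
next
  case equal
  show ?thesis
    by (rule that[of "\<lambda>t. 1" "\<lambda>t. t"]) (use equal in \<open>auto intro!: derivative_eq_intros\<close>)
next
  case greater
  define w where "w = sqrt k"
  have w: "w \<noteq> 0" "k = w * w" using greater by (auto simp: w_def)
  show ?thesis
    by (rule that[of "\<lambda>t. cosh (w * t)" "\<lambda>t. sinh (w * t) / w"])
       (use w in \<open>auto intro!: derivative_eq_intros\<close>)
qed

text \<open>The Jacobian of \<open>Xb\<close> at \<open>(0, 0, M)\<close>.\<close>

definition Xb_lin :: "real \<Rightarrow> real \<Rightarrow> real^3 \<Rightarrow> real^3" where
  "Xb_lin \<beta> M v = vector [(M + \<beta>) * v$2, (M - \<beta>) * v$1, 0]"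

lemma Xb_lin_nth [simp]:
  "Xb_lin \<beta> M v $ 1 = (M + \<beta>) * v$2" "Xb_lin \<beta> M v $ 2 = (M - \<beta>) * v$1" "Xb_lin \<beta> M v $ 3 = 0"
  by (simp_all add: Xb_lin_def)

lemma norm_Xb_lin: "norm (Xb_lin \<beta> M v) \<le> (\<bar>M + \<beta>\<bar> + \<bar>M - \<beta>\<bar>) * norm v"
proof -
  have "norm (Xb_lin \<beta> M v) \<le> \<bar>M + \<beta>\<bar> * \<bar>v$2\<bar> + \<bar>M - \<beta>\<bar> * \<bar>v$1\<bar>"
    using norm_le_components_3[of "Xb_lin \<beta> M v"] by (simp add: abs_mult)
  also have "\<dots> \<le> \<bar>M + \<beta>\<bar> * norm v + \<bar>M - \<beta>\<bar> * norm v"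
    by (intro add_mono mult_left_mono component_le_norm_cart) auto
  finally show ?thesis by (simp add: algebra_simps)
qed

text \<open>\<open>Xb\<close> is a quadratic polynomial, so the remainder is exactly the vector with
  entries \<open>w$2 * w$3\<close>, \<open>w$1 * w$3\<close> and
  \<open>- (w$1 * w$2)\<close>.\<close>

lemma Xb_remainder:
  "norm (Xb \<beta> (vector [0, 0, M] + w) - Xb_lin \<beta> M w) \<le> 3 * (norm w)\<^sup>2"
proof -
  have "\<bar>w$i * w$j\<bar> \<le> (norm w)\<^sup>2" for i j
    unfolding abs_mult power2_eq_square by (intro mult_mono component_le_norm_cart) auto
  from this[of 2 3] this[of 1 3] this[of 1 2] show ?thesis
    using norm_le_components_3[of "Xb \<beta> (vector [0, 0, M] + w) - Xb_lin \<beta> M w"]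
    by (simp add: algebra_simps)
qed

text \<open>Gronwall is applied twice. The first application, inside \<open>sol_diff_bound\<close>,
  shows that the orbit stays within a multiple of \<open>norm h\<close> of the equilibrium up to
  time \<open>t\<close>, so the remainder of the field is of order \<open>(norm h)\<^sup>2\<close>.
  The second treats the difference to the linear solution \<open>U\<close>, which starts at 0 and is
  driven by that remainder alone.\<close>

lemma flow_linearized_error:
  fixes U :: "real \<Rightarrow> real^3" and t :: real
  assumes U: "U 0 = h" "\<And>s. (U has_vector_derivative Xb_lin \<beta> M (U s)) (at s)"
    and h: "norm h \<le> 1"
  defines "K \<equiv> exp ((2 * (6 * (2 * (\<bar>M\<bar> + 1)) + 2 * \<bar>\<beta>\<bar>) + 1) * \<bar>t\<bar>)"
  shows "norm (flow (Xb \<beta>) t (vector [0, 0, M] + h) - vector [0, 0, M] - U t)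
    \<le> sqrt (exp ((2 * (\<bar>M + \<beta>\<bar> + \<bar>M - \<beta>\<bar>) + 1) * \<bar>t\<bar>) * ((3 * K)\<^sup>2 * \<bar>t\<bar>)) * (norm h)\<^sup>2"
proof -
  define m :: "real^3" where "m = vector [0, 0, M]"
  define \<phi> where "\<phi> s = flow (Xb \<beta>) s (m + h)" for s
  \<comment> \<open>Starting points have norm at most \<open>\<bar>M\<bar> + 1\<close>, and
    \<open>energy\<close> is at most twice the squared norm.\<close>
  define R where "R = 2 * (\<bar>M\<bar> + 1)"
  have nm: "norm m \<le> \<bar>M\<bar>" using norm_le_components_3[of m] by (simp add: m_def)
  have en: "energy p \<le> R\<^sup>2" if "norm p \<le> \<bar>M\<bar> + 1" for p
  proof -
    have "energy p \<le> 2 * (\<bar>M\<bar> + 1)\<^sup>2"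
      by (rule order_trans[OF energy_le_norm]) (intro mult_left_mono power_mono that, auto)
    also have "\<dots> \<le> R\<^sup>2" unfolding R_def power_mult_distrib by (intro mult_right_mono) auto
    finally show ?thesis .
  qed
  have sol\<phi>: "sol (Xb \<beta>) (m + h) \<phi>" unfolding \<phi>_def by (rule sol_flow)
  have solm: "sol (Xb \<beta>) m (\<lambda>_. m)" by (simp add: sol_def m_def)
  have "norm (m + h) \<le> \<bar>M\<bar> + 1" using norm_triangle_ineq[of m h] nm h by simp
  then have w: "(norm (\<phi> s - m))\<^sup>2 \<le> K * (norm h)\<^sup>2" if "\<bar>s\<bar> \<le> \<bar>t\<bar>" for s
  proof -
    have "(norm (\<phi> s - m))\<^sup>2 \<le> exp ((2 * (6 * R + 2 * \<bar>\<beta>\<bar>) + 1) * \<bar>s\<bar>) * (norm (m + h - m))\<^sup>2"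
      using nm \<open>norm (m + h) \<le> _\<close> by (intro sol_diff_bound[OF sol\<phi> solm] en) (auto simp: R_def)
    also have "\<dots> \<le> K * (norm h)\<^sup>2"
      unfolding K_def R_def[symmetric] using that
      by (intro mult_mono) (auto simp: R_def intro!: mult_left_mono)
    finally show ?thesis .
  qed
  have "(norm (\<phi> t - m - U t))\<^sup>2 \<le> exp ((2 * (\<bar>M + \<beta>\<bar> + \<bar>M - \<beta>\<bar>) + 1) * \<bar>t\<bar>) *
      ((norm (\<phi> 0 - m - U 0))\<^sup>2 + (3 * K * (norm h)\<^sup>2)\<^sup>2 * \<bar>t\<bar>)"
  proof (rule gronwall[where g = "\<lambda>s. \<phi> s - m - U s"])
    fix s assume s: "\<bar>s\<bar> \<le> \<bar>t\<bar>"
    show "((\<lambda>s. \<phi> s - m - U s) has_vector_derivative Xb \<beta> (\<phi> s) - Xb_lin \<beta> M (U s)) (at s)"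
      using sol\<phi> U by (auto simp: sol_def intro!: derivative_eq_intros)
    have "Xb \<beta> (\<phi> s) - Xb_lin \<beta> M (U s) =
        Xb_lin \<beta> M (\<phi> s - m - U s) + (Xb \<beta> (m + (\<phi> s - m)) - Xb_lin \<beta> M (\<phi> s - m))"
      by (simp add: vec_eq_iff forall_3 algebra_simps)
    then have "norm (Xb \<beta> (\<phi> s) - Xb_lin \<beta> M (U s))
        \<le> norm (Xb_lin \<beta> M (\<phi> s - m - U s)) + norm (Xb \<beta> (m + (\<phi> s - m)) - Xb_lin \<beta> M (\<phi> s - m))"
      by (metis norm_triangle_ineq)
    also have "\<dots> \<le> (\<bar>M + \<beta>\<bar> + \<bar>M - \<beta>\<bar>) * norm (\<phi> s - m - U s) + 3 * (norm (\<phi> s - m))\<^sup>2"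
      unfolding m_def by (intro add_mono norm_Xb_lin Xb_remainder)
    also have "\<dots> \<le> (\<bar>M + \<beta>\<bar> + \<bar>M - \<beta>\<bar>) * norm (\<phi> s - m - U s) + 3 * K * (norm h)\<^sup>2"
      using w[OF s] by simp
    finally show "norm (Xb \<beta> (\<phi> s) - Xb_lin \<beta> M (U s))
        \<le> (\<bar>M + \<beta>\<bar> + \<bar>M - \<beta>\<bar>) * norm (\<phi> s - m - U s) + 3 * K * (norm h)\<^sup>2" .
  qed simp
  also have "\<phi> 0 - m - U 0 = 0" using U by (simp add: \<phi>_def)
  finally have "(norm (\<phi> t - m - U t))\<^sup>2 \<le>
      (exp ((2 * (\<bar>M + \<beta>\<bar> + \<bar>M - \<beta>\<bar>) + 1) * \<bar>t\<bar>) * ((3 * K)\<^sup>2 * \<bar>t\<bar>)) * ((norm h)\<^sup>2)\<^sup>2"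
    by (simp add: power_mult_distrib algebra_simps)
  from real_sqrt_le_mono[OF this] show ?thesis
    unfolding real_sqrt_mult[of _ "((norm h)\<^sup>2)\<^sup>2"] real_sqrt_abs abs_norm_cancel abs_power2
    by (simp only: \<phi>_def m_def)
qed

theorem linearization_Xb: "linearization (Xb \<beta>) (vector [0, 0, M]) v = Xb_lin \<beta> M v"
proof -
  define m :: "real^3" where "m = vector [0, 0, M]"
  \<comment> \<open>On the horizontal plane \<open>Xb_lin\<close> squares to multiplication by
    \<open>M\<^sup>2 - \<beta>\<^sup>2\<close>, so its exponential there is \<open>c t\<close> times
    the identity plus \<open>s t\<close> times \<open>Xb_lin\<close>.\<close>
  obtain c s where cs: "c 0 = 1" "s 0 = 0"
    "\<And>t. (c has_real_derivative (M\<^sup>2 - \<beta>\<^sup>2) * s t) (at t)" "\<And>t. (s has_real_derivative c t) (at t)"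
    using cosh_sinh_like_pair by blast
  define U :: "real^3 \<Rightarrow> real \<Rightarrow> real^3" where
    "U v t = vector [c t * v$1 + (M + \<beta>) * s t * v$2, c t * v$2 + (M - \<beta>) * s t * v$1, v$3]" for v t
  have U0: "U v 0 = v" for v by (simp add: U_def cs vec_eq_iff forall_3)
  have U': "(U v has_vector_derivative Xb_lin \<beta> M (U v t)) (at t)" for v t
    unfolding U_def[abs_def] Xb_lin_def
    by (rule has_vector_derivative_vector_3)
       (auto intro!: derivative_eq_intros cs simp: algebra_simps power2_eq_square)
  have "(flow (Xb \<beta>) t has_derivative (\<lambda>v. U v t)) (at m)" for t
  proof (rule has_derivative_quadratic_remainder)
    have "linear (\<lambda>v. U v t)"
      by (rule linearI) (simp_all add: U_def vec_eq_iff forall_3 algebra_simps)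
    then show "bounded_linear (\<lambda>v. U v t)" by (simp add: linear_conv_bounded_linear)
    have "flow (Xb \<beta>) t m = m" by (rule flow_equilibrium) (simp add: m_def)
    then show "norm (flow (Xb \<beta>) t (m + h) - flow (Xb \<beta>) t m - U h t) \<le>
        sqrt (exp ((2 * (\<bar>M + \<beta>\<bar> + \<bar>M - \<beta>\<bar>) + 1) * \<bar>t\<bar>) *
          ((3 * exp ((2 * (6 * (2 * (\<bar>M\<bar> + 1)) + 2 * \<bar>\<beta>\<bar>) + 1) * \<bar>t\<bar>))\<^sup>2 * \<bar>t\<bar>)) * (norm h)\<^sup>2"
      if "norm h \<le> 1" for h
      using flow_linearized_error[OF U0 U' that] by (simp add: m_def)
  qed
  then have "frechet_derivative (flow (Xb \<beta>) t) (at m) = (\<lambda>v. U v t)" for t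
    using frechet_derivative_at by metis
  then have "linearization (Xb \<beta>) m v = vector_derivative (U v) (at 0)"
    by (simp add: linearization_def)
  also have "\<dots> = Xb_lin \<beta> M v"
    using vector_derivative_at[OF U'[of v 0]] by (simp add: U0)
  finally show ?thesis by (simp add: m_def)
qed

section \<open>The tangent plane of the surface\<close>

lemma mem_Sig:
  assumes "\<beta> \<noteq> 0"
  shows "p \<in> Sig \<beta> (- \<beta> * M) \<longleftrightarrow> p$3 = M + ((p$2)\<^sup>2 - (p$1)\<^sup>2) / (4 * \<beta>)"
  using assms by (auto simp: Sig_def power2_eq_square field_simps)

lemma tangent_space_Sig:
  assumes "\<beta> \<noteq> 0"
  shows "tangent_space (Sig \<beta> (- \<beta> * M)) (vector [0, 0, M]) = {v. v$3 = 0}" (is "?T = _")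
proof (intro equalityI subsetI)
  fix v assume "v \<in> ?T"
  then obtain c where c: "c 0 = vector [0, 0, M]" "\<And>t. c t \<in> Sig \<beta> (- \<beta> * M)"
    "(c has_vector_derivative v) (at 0)"
    unfolding tangent_space_def by blast
  note d = has_vector_derivative_component[OF c(3)]
  have "((\<lambda>t. M + ((c t$2)\<^sup>2 - (c t$1)\<^sup>2) * inverse (4 * \<beta>)) has_real_derivative 0) (at 0)"
    by (auto intro!: derivative_eq_intros d[of 1] d[of 2] simp: c)
  moreover have "(\<lambda>t. M + ((c t$2)\<^sup>2 - (c t$1)\<^sup>2) * inverse (4 * \<beta>)) = (\<lambda>t. c t $ 3)"
    by (rule ext) (simp only: c(2)[unfolded mem_Sig[OF assms]] divide_inverse)
  ultimately have "((\<lambda>t. c t $ 3) has_real_derivative 0) (at 0)" by simp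
  from DERIV_unique[OF d[of 3] this] show "v \<in> {v. v$3 = 0}" by simp
next
  fix v :: "real^3" assume v: "v \<in> {v. v$3 = 0}"
  \<comment> \<open>The line in direction \<open>v\<close>, lifted to the graph; the height is
    quadratic in \<open>t\<close> and does not affect the velocity at 0.\<close>
  define c :: "real \<Rightarrow> real^3" where
    "c t = vector [t * v$1, t * v$2, M + ((t * v$2)\<^sup>2 - (t * v$1)\<^sup>2) * inverse (4 * \<beta>)]" for t
  have "(c has_vector_derivative vector [v$1, v$2, 0]) (at 0)"
    unfolding c_def[abs_def]
    by (rule has_vector_derivative_vector_3) (auto intro!: derivative_eq_intros)
  moreover have "vector [v$1, v$2, 0] = v" using v by (simp add: vec_eq_iff forall_3)
  moreover have "c 0 = vector [0, 0, M]" by (simp add: c_def)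
  moreover have "c t \<in> Sig \<beta> (- \<beta> * M)" for t
    unfolding mem_Sig[OF assms] by (simp add: c_def field_simps)
  ultimately show "v \<in> ?T" unfolding tangent_space_def by auto
qed

section \<open>The characteristic polynomial in an arbitrary basis\<close>

lemma mem_span_pair: "x \<in> span {a, b} \<longleftrightarrow> (\<exists>j k. x = j *\<^sub>R a + k *\<^sub>R b)"
  for a b :: "'a::real_vector"
  by (auto simp: span_insert span_singleton algebra_simps)

lemma horizontal_plane_basis:
  "span {axis 1 1, axis 2 1} = {v::real^3. v$3 = 0}" "independent {axis 1 1, axis 2 1 :: real^3}"
proof -
  show "span {axis 1 1, axis 2 1} = {v::real^3. v$3 = 0}"
  proof (rule set_eqI)
    fix v :: "real^3"
    have "v = (v$1) *\<^sub>R axis 1 1 + (v$2) *\<^sub>R axis 2 1" if "v$3 = 0"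
      using that by (simp add: vec_eq_iff forall_3 axis_def)
    then show "v \<in> span {axis 1 1, axis 2 1} \<longleftrightarrow> v \<in> {v. v$3 = 0}"
      unfolding mem_span_pair by (auto simp: axis_def)
  qed
  have "{axis 1 1, axis 2 1 :: real^3} \<subseteq> Basis" by (auto simp: axis_in_Basis_iff)
  then show "independent {axis 1 1, axis 2 1 :: real^3}"
    using independent_Basis independent_mono by blast
qed

lemma dim_horizontal_plane: "dim {v::real^3. v$3 = 0} = 2"
  using dim_span_eq_card_independent[OF horizontal_plane_basis(2)]
  by (simp add: horizontal_plane_basis(1) axis_eq_axis)

lemma charpoly_2:
  fixes A :: "nat \<Rightarrow> nat \<Rightarrow> real"
  shows "(\<Sum>p | p permutes {..<2}. of_int (sign p) *
             (\<Prod>i<2. (if i = p i then [:0, 1:] else 0) - [:A i (p i):])) =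
    [:A 0 0 * A 1 1 - A 0 1 * A 1 0, - (A 0 0 + A 1 1), 1:]"
proof -
  have f: "finite {1::nat}" "0 \<notin> {1::nat}" by auto
  have "{..<2} = {0, 1::nat}" by auto
  then have "(\<Sum>p | p permutes {..<2}. of_int (sign p) *
        (\<Prod>i<2. (if i = p i then [:0, 1:] else 0) - [:A i (p i):])) =
      (\<Sum>p | p permutes {0, 1}. of_int (sign p) *
        (((if 0 = p 0 then [:0, 1:] else 0) - [:A 0 (p 0):]) *
         ((if 1 = p 1 then [:0, 1:] else 0) - [:A 1 (p 1):])))"
    by simp
  also have "\<dots> = [:A 0 0 * A 1 1 - A 0 1 * A 1 0, - (A 0 0 + A 1 1), 1:]"
    unfolding sum_over_permutations_insert[OF f] permutes_sing
    by (simp add: sign_swap_id sign_id transpose_def algebra_simps)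
  finally show ?thesis .
qed

text \<open>\<open>charpoly_on\<close> selects its value by \<open>SOME\<close>, so besides
  exhibiting one basis it must be shown that every basis gives the same trace and
  determinant.\<close>

theorem charpoly_Xb_lin:
  "charpoly_on {v. v$3 = 0} (Xb_lin \<beta> M) = [:\<beta>\<^sup>2 - M\<^sup>2, 0, 1:]"
proof -
  define V where "V = {v::real^3. v$3 = 0}"
  define good where "good b A \<longleftrightarrow> inj_on b {..<2} \<and> independent (b ` {..<2}) \<and> span (b ` {..<2}) = V \<and>
      (\<forall>j<2. Xb_lin \<beta> M (b j) = (\<Sum>i<2. A i j *\<^sub>R b i))" for b :: "nat \<Rightarrow> real^3" and A
  have two: "{..<2} = {0, 1::nat}" by auto
  have unique: "[:A 0 0 * A 1 1 - A 0 1 * A 1 0, - (A 0 0 + A 1 1), 1:] = [:\<beta>\<^sup>2 - M\<^sup>2, 0, 1:]"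
    if "good b A" for b A
  proof -
    have sp: "span {b 0, b 1} = V" using that by (simp add: good_def two)
    have "axis 1 1 \<in> V" "axis 2 1 \<in> V" by (auto simp: V_def axis_def)
    then obtain j k j' k' where jk: "axis 1 1 = j *\<^sub>R b 0 + k *\<^sub>R b 1" "axis 2 1 = j' *\<^sub>R b 0 + k' *\<^sub>R b 1"
      unfolding sp[symmetric] mem_span_pair by blast
    have e: "j * b 0 $ 1 + k * b 1 $ 1 = 1" "j * b 0 $ 2 + k * b 1 $ 2 = 0"
      "j' * b 0 $ 1 + k' * b 1 $ 1 = 0" "j' * b 0 $ 2 + k' * b 1 $ 2 = 1"
      using arg_cong[OF jk(1), of "\<lambda>v. v $ 1"] arg_cong[OF jk(1), of "\<lambda>v. v $ 2"]
        arg_cong[OF jk(2), of "\<lambda>v. v $ 1"] arg_cong[OF jk(2), of "\<lambda>v. v $ 2"]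
      by (auto simp: axis_def)
    \<comment> \<open>The determinant of the basis in horizontal coordinates. Its product with the
      determinant of the coefficients \<open>j, k, j', k'\<close> is 1, so it can be cancelled from
      the identities for trace and determinant of \<open>A\<close>.\<close>
    define D where "D = b 0 $ 1 * b 1 $ 2 - b 0 $ 2 * b 1 $ 1"
    have "(j * k' - j' * k) * D = (j * b 0 $ 1 + k * b 1 $ 1) * (j' * b 0 $ 2 + k' * b 1 $ 2)
        - (j * b 0 $ 2 + k * b 1 $ 2) * (j' * b 0 $ 1 + k' * b 1 $ 1)"
      by (simp add: D_def algebra_simps)
    then have D: "D \<noteq> 0" using e by auto
    have L: "Xb_lin \<beta> M (b 0) = A 0 0 *\<^sub>R b 0 + A 1 0 *\<^sub>R b 1" "Xb_lin \<beta> M (b 1) = A 0 1 *\<^sub>R b 0 + A 1 1 *\<^sub>R b 1"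
      using that by (auto simp: good_def two)
    have c: "(M + \<beta>) * b 0 $ 2 = A 0 0 * b 0 $ 1 + A 1 0 * b 1 $ 1"
      "(M - \<beta>) * b 0 $ 1 = A 0 0 * b 0 $ 2 + A 1 0 * b 1 $ 2"
      "(M + \<beta>) * b 1 $ 2 = A 0 1 * b 0 $ 1 + A 1 1 * b 1 $ 1"
      "(M - \<beta>) * b 1 $ 1 = A 0 1 * b 0 $ 2 + A 1 1 * b 1 $ 2"
      using arg_cong[OF L(1), of "\<lambda>v. v $ 1"] arg_cong[OF L(1), of "\<lambda>v. v $ 2"]
        arg_cong[OF L(2), of "\<lambda>v. v $ 1"] arg_cong[OF L(2), of "\<lambda>v. v $ 2"] by auto
    have "D * (A 0 0 + A 1 1) = 0" using c unfolding D_def by algebra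
    moreover have "D * (A 0 0 * A 1 1 - A 0 1 * A 1 0) = D * (\<beta>\<^sup>2 - M\<^sup>2)"
      using c unfolding D_def by algebra
    ultimately show ?thesis using D by simp
  qed
  define b0 :: "nat \<Rightarrow> real^3" where "b0 i = (if i = 0 then axis 1 1 else axis 2 1)" for i
  define A0 where "A0 i j = (if i = 1 \<and> j = 0 then M - \<beta> else if i = 0 \<and> j = 1 then M + \<beta> else 0)"
    for i j :: nat
  have img: "b0 ` {..<2} = {axis 1 1, axis 2 1}" by (auto simp: two b0_def)
  have "good b0 A0" unfolding good_def img
  proof (intro conjI horizontal_plane_basis(2))
    show "inj_on b0 {..<2}" by (auto simp: two b0_def axis_eq_axis)
    show "span {axis 1 1, axis 2 1} = V" by (simp add: V_def horizontal_plane_basis(1))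
    show "\<forall>j<2. Xb_lin \<beta> M (b0 j) = (\<Sum>i<2. A0 i j *\<^sub>R b0 i)"
      by (auto simp: two b0_def A0_def less_2_cases_iff vec_eq_iff forall_3 axis_def)
  qed
  moreover have "charpoly_on V (Xb_lin \<beta> M) = (SOME q. \<exists>b A. good b A \<and>
      q = [:A 0 0 * A 1 1 - A 0 1 * A 1 0, - (A 0 0 + A 1 1), 1:])"
    unfolding charpoly_on_def V_def dim_horizontal_plane charpoly_2 good_def by simp
  moreover have "(SOME q. \<exists>b A. good b A \<and>
      q = [:A 0 0 * A 1 1 - A 0 1 * A 1 0, - (A 0 0 + A 1 1), 1:]) = [:\<beta>\<^sup>2 - M\<^sup>2, 0, 1:]"
  proof (rule some_equality)
    show "\<exists>b A. good b A \<and>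
        [:\<beta>\<^sup>2 - M\<^sup>2, 0, 1:] = [:A 0 0 * A 1 1 - A 0 1 * A 1 0, - (A 0 0 + A 1 1), 1:]"
      using \<open>good b0 A0\<close> unique[OF \<open>good b0 A0\<close>] by metis
  qed (use unique in blast)
  ultimately have "charpoly_on V (Xb_lin \<beta> M) = [:\<beta>\<^sup>2 - M\<^sup>2, 0, 1:]" by simp
  then show ?thesis by (simp add: V_def)
qed

section \<open>Stability\<close>

text \<open>Equals \<open>energy p + (4 * M / \<beta>) * F p + 2 * M\<^sup>2\<close>, where
  \<open>F\<close> is the function whose level set is \<open>Sig\<close>. The multiplier is the one
  that makes \<open>(0, 0, M)\<close> a critical point, and the constant makes the value there
  0.\<close>

definition lyap :: "real \<Rightarrow> real \<Rightarrow> real^3 \<Rightarrow> real" where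
  "lyap \<beta> M p = (1 - M / \<beta>) * (p$1)\<^sup>2 + (1 + M / \<beta>) * (p$2)\<^sup>2 + 2 * (p$3 - M)\<^sup>2"

lemma equilibrium_in_Sig: "\<beta> \<noteq> 0 \<Longrightarrow> vector [0, 0, M] \<in> Sig \<beta> (- \<beta> * M)"
  by (simp add: Sig_def)

lemma lyap_equilibrium [simp]: "lyap \<beta> M (vector [0, 0, M]) = 0"
  by (simp add: lyap_def)

lemma lyap_conserved:
  assumes "\<beta> \<noteq> 0"
  shows "lyap \<beta> M (flow (Xb \<beta>) t p) = lyap \<beta> M p"
proof -
  have "lyap \<beta> M (flow (Xb \<beta>) t p) = lyap \<beta> M (flow (Xb \<beta>) 0 p)"
  proof (rule constant_if_zero_derivative[where f = "\<lambda>s. lyap \<beta> M (flow (Xb \<beta>) s p)"])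
    fix s
    define x y z where "x = flow (Xb \<beta>) s p $ 1" and "y = flow (Xb \<beta>) s p $ 2"
      and "z = flow (Xb \<beta>) s p $ 3"
    have "((\<lambda>s. lyap \<beta> M (flow (Xb \<beta>) s p)) has_real_derivative
        (1 - M / \<beta>) * (2 * x * (y * (z + \<beta>))) + (1 + M / \<beta>) * (2 * y * (x * (z - \<beta>)))
          + 2 * (2 * (z - M) * (- (x * y)))) (at s)"
      unfolding lyap_def x_def y_def z_def
      by (rule derivative_eq_intros flow_coordinates refl | simp)+
    also have "(1 - M / \<beta>) * (2 * x * (y * (z + \<beta>))) + (1 + M / \<beta>) * (2 * y * (x * (z - \<beta>)))
          + 2 * (2 * (z - M) * (- (x * y))) = 0"
      using assms by (simp add: field_simps)
    finally show "((\<lambda>s. lyap \<beta> M (flow (Xb \<beta>) s p)) has_real_derivative 0) (at s)" .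
  qed
  then show ?thesis by simp
qed

lemma dist_equilibrium: "(dist (p::real^3) (vector [0, 0, M]))\<^sup>2 = (p$1)\<^sup>2 + (p$2)\<^sup>2 + (p$3 - M)\<^sup>2"
  by (simp add: dist_norm norm_3)

lemma abs_ratio_less_1: "\<bar>M\<bar> < \<bar>\<beta>\<bar> \<Longrightarrow> \<bar>M / \<beta>\<bar> < 1" for M \<beta> :: real
  by simp

lemma quadratic_part_ge:
  fixes x y :: real
  shows "(1 - \<bar>M / \<beta>\<bar>) * (x\<^sup>2 + y\<^sup>2) \<le> (1 - M / \<beta>) * x\<^sup>2 + (1 + M / \<beta>) * y\<^sup>2"
proof -
  have "(1 - \<bar>M / \<beta>\<bar>) * x\<^sup>2 \<le> (1 - M / \<beta>) * x\<^sup>2" by (intro mult_right_mono zero_le_power2) linarith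
  moreover have "(1 - \<bar>M / \<beta>\<bar>) * y\<^sup>2 \<le> (1 + M / \<beta>) * y\<^sup>2" by (intro mult_right_mono zero_le_power2) linarith
  ultimately show ?thesis by (simp add: distrib_left)
qed

text \<open>None of the three coefficients of \<open>lyap\<close> is below
  \<open>1 - \<bar>M / \<beta>\<bar>\<close>, which is positive exactly in the stable case.\<close>

lemma lyap_ge_dist: "(1 - \<bar>M / \<beta>\<bar>) * (dist p (vector [0, 0, M]))\<^sup>2 \<le> lyap \<beta> M p"
proof -
  have "(1 - \<bar>M / \<beta>\<bar>) * (p$3 - M)\<^sup>2 \<le> 2 * (p$3 - M)\<^sup>2" by (intro mult_right_mono zero_le_power2) linarith
  then show ?thesis
    using quadratic_part_ge[of M \<beta> "p$1" "p$2"]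
    unfolding dist_equilibrium lyap_def distrib_left by linarith
qed

lemma dist_less_if_lyap_less:
  assumes "\<bar>M\<bar> < \<bar>\<beta>\<bar>" "0 < e" "lyap \<beta> M p < (1 - \<bar>M / \<beta>\<bar>) * e\<^sup>2"
  shows "dist p (vector [0, 0, M]) < e"
proof -
  have "(1 - \<bar>M / \<beta>\<bar>) * (dist p (vector [0, 0, M]))\<^sup>2 < (1 - \<bar>M / \<beta>\<bar>) * e\<^sup>2"
    using lyap_ge_dist assms(3) by (rule le_less_trans)
  then have "(dist p (vector [0, 0, M]))\<^sup>2 < e\<^sup>2"
    using abs_ratio_less_1[OF assms(1)] by (simp only: mult_less_cancel_left_pos diff_gt_0_iff_gt)
  then show ?thesis using assms(2) by (simp add: power_less_imp_less_base)
qed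

lemma lyap_eq_0_iff:
  assumes "\<bar>M\<bar> < \<bar>\<beta>\<bar>"
  shows "lyap \<beta> M p = 0 \<longleftrightarrow> p = vector [0, 0, M]"
proof
  assume "lyap \<beta> M p = 0"
  then have "dist p (vector [0, 0, M]) < e" if "0 < e" for e
    using that abs_ratio_less_1[OF assms] by (intro dist_less_if_lyap_less[OF assms]) auto
  then show "p = vector [0, 0, M]" by (metis dist_eq_0_iff less_irrefl zero_less_dist_iff)
qed simp

lemma lyap_nonneg:
  assumes "\<bar>M\<bar> < \<bar>\<beta>\<bar>"
  shows "0 \<le> lyap \<beta> M p"
  by (rule order_trans[OF _ lyap_ge_dist]) (use abs_ratio_less_1[OF assms] in simp)

lemma continuous_on_lyap: "continuous_on S (lyap \<beta> M)"
  unfolding lyap_def[abs_def] by (intro continuous_intros)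

theorem equilibrium_stable:
  assumes "\<beta> \<noteq> 0" "\<bar>M\<bar> < \<bar>\<beta>\<bar>"
  shows "lyapunov_stable_on (Xb \<beta>) (Sig \<beta> (- \<beta> * M)) (vector [0, 0, M])"
  unfolding lyapunov_stable_on_def
proof (intro conjI allI impI equilibrium_in_Sig assms(1))
  fix e :: real assume e: "0 < e"
  define \<kappa> where "\<kappa> = 1 - \<bar>M / \<beta>\<bar>"
  have "0 < \<kappa>" using abs_ratio_less_1[OF assms(2)] by (simp add: \<kappa>_def)
  then have "0 < \<kappa> * e\<^sup>2" using e by simp
  moreover have "continuous_on UNIV (lyap \<beta> M)" by (rule continuous_on_lyap)
  ultimately obtain d where d: "0 < d"
    "\<And>p. dist p (vector [0, 0, M]) < d \<Longrightarrow> dist (lyap \<beta> M p) (lyap \<beta> M (vector [0, 0, M])) < \<kappa> * e\<^sup>2"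
    unfolding continuous_on_iff by (meson UNIV_I)
  have "dist (flow (Xb \<beta>) t p) (vector [0, 0, M]) < e" if "dist p (vector [0, 0, M]) < d" for p t
  proof (rule dist_less_if_lyap_less[OF assms(2) e])
    show "lyap \<beta> M (flow (Xb \<beta>) t p) < (1 - \<bar>M / \<beta>\<bar>) * e\<^sup>2"
      unfolding lyap_conserved[OF assms(1)] \<kappa>_def[symmetric]
      using d(2)[OF that] by (simp add: dist_real_def)
  qed
  with d(1) show "\<exists>d>0. \<forall>x\<in>Sig \<beta> (- \<beta> * M). dist x (vector [0, 0, M]) < d \<longrightarrow>
      (\<forall>t\<ge>0. dist (flow (Xb \<beta>) t x) (vector [0, 0, M]) < e)" by blast
qed simp

text \<open>While an orbit stays close to the equilibrium, \<open>sgn M * x * y\<close> grows at least linearly.\<close>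
theorem equilibrium_unstable:
  assumes "\<beta> \<noteq> 0" "\<bar>\<beta>\<bar> < \<bar>M\<bar>"
  shows "unstable_on (Xb \<beta>) (Sig \<beta> (- \<beta> * M)) (vector [0, 0, M])"
  unfolding unstable_on_def
proof (intro conjI equilibrium_in_Sig assms(1) notI)
  assume stable: "lyapunov_stable_on (Xb \<beta>) (Sig \<beta> (- \<beta> * M)) (vector [0, 0, M])"
  \<comment> \<open>Half the gap: as long as \<open>z\<close> is within \<open>c\<close> of
    \<open>M\<close>, both \<open>\<sigma> * (z + \<beta>)\<close> and
    \<open>\<sigma> * (z - \<beta>)\<close> are at least
    \<open>\<bar>M\<bar> - c - \<bar>\<beta>\<bar> = c\<close>.\<close>
  define c where "c = (\<bar>M\<bar> - \<bar>\<beta>\<bar>) / 2"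
  define \<sigma> where "\<sigma> = sgn M"
  have "2 * c = \<bar>M\<bar> - \<bar>\<beta>\<bar>" by (simp add: c_def)
  have c: "0 < c" using assms by (simp add: c_def)
  have \<sigma>: "\<bar>\<sigma>\<bar> = 1" "\<sigma> * \<sigma> = 1" "\<sigma> * M = \<bar>M\<bar>"
    using assms by (auto simp: \<sigma>_def sgn_real_def split: if_splits)
  obtain d where d: "0 < d" "\<And>p t. p \<in> Sig \<beta> (- \<beta> * M) \<Longrightarrow> dist p (vector [0, 0, M]) < d \<Longrightarrow> 0 \<le> t \<Longrightarrow>
      dist (flow (Xb \<beta>) t p) (vector [0, 0, M]) < c"
    using stable c unfolding lyapunov_stable_on_def by meson
  define r where "r = d / 2"
  \<comment> \<open>Equal squares of the first two coordinates put \<open>p\<close> on the surface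
    at height \<open>M\<close>, and the sign makes the growing function start at the positive value
    \<open>r\<^sup>2\<close>.\<close>
  define p :: "real^3" where "p = vector [r, \<sigma> * r, M]"
  have p: "p \<in> Sig \<beta> (- \<beta> * M)"
    unfolding mem_Sig[OF assms(1)] using \<sigma> by (simp add: p_def power_mult_distrib power2_eq_square)
  have "(dist p (vector [0, 0, M]))\<^sup>2 = 2 * r\<^sup>2"
    unfolding dist_equilibrium using \<sigma> by (simp add: p_def power_mult_distrib power2_eq_square)
  also have "\<dots> < d\<^sup>2" using d(1) by (simp add: r_def power_divide)
  finally have "dist p (vector [0, 0, M]) < d" using d(1) by (simp add: power_less_imp_less_base)
  note near = d(2)[OF p this]
  define x y z where "x t = flow (Xb \<beta>) t p $ 1" and "y t = flow (Xb \<beta>) t p $ 2"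
    and "z t = flow (Xb \<beta>) t p $ 3" for t
  have near': "\<bar>x t\<bar> \<le> c" "\<bar>y t\<bar> \<le> c" "\<bar>z t - M\<bar> \<le> c" if "0 \<le> t" for t
    using near[OF that] component_le_norm_cart[of "flow (Xb \<beta>) t p - vector [0, 0, M]" 1]
      component_le_norm_cart[of "flow (Xb \<beta>) t p - vector [0, 0, M]" 2]
      component_le_norm_cart[of "flow (Xb \<beta>) t p - vector [0, 0, M]" 3]
    by (simp_all add: x_def y_def z_def dist_norm)
  define f where "f t = \<sigma> * (x t * y t)" for t
  define f' where "f' t = \<sigma> * ((y t)\<^sup>2 * (z t + \<beta>) + (x t)\<^sup>2 * (z t - \<beta>))" for t
  have der: "(f has_real_derivative f' t) (at t)" for t
    unfolding f_def[abs_def] f'_def x_def y_def z_def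
    by (rule derivative_eq_intros flow_coordinates refl)+ (simp add: power2_eq_square algebra_simps)
  have grow: "2 * c * f t \<le> f' t" "0 \<le> f' t" if "0 \<le> t" for t
  proof -
    have "\<bar>\<sigma> * (z t - M)\<bar> \<le> c" using near'[OF that] \<sigma> by (simp add: abs_mult)
    then have "\<bar>M\<bar> - c \<le> \<sigma> * z t" using \<sigma> by (simp add: right_diff_distrib)
    moreover have "\<bar>\<sigma> * \<beta>\<bar> = \<bar>\<beta>\<bar>" using \<sigma> by (simp add: abs_mult)
    ultimately have "c \<le> \<sigma> * (z t + \<beta>)" "c \<le> \<sigma> * (z t - \<beta>)"
      using abs_ge_self[of "\<sigma> * \<beta>"] abs_ge_minus_self[of "\<sigma> * \<beta>"] \<open>2 * c = _\<close>
      by (simp_all only: distrib_left right_diff_distrib)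
    then have "(y t)\<^sup>2 * c + (x t)\<^sup>2 * c \<le> (y t)\<^sup>2 * (\<sigma> * (z t + \<beta>)) + (x t)\<^sup>2 * (\<sigma> * (z t - \<beta>))"
      by (intro add_mono mult_left_mono) auto
    then have f': "c * ((x t)\<^sup>2 + (y t)\<^sup>2) \<le> f' t" by (simp add: f'_def algebra_simps)
    have "2 * f t \<le> 2 * (\<bar>x t\<bar> * \<bar>y t\<bar>)"
      using abs_ge_self[of "f t"] \<sigma> by (simp add: f_def abs_mult)
    also have "\<dots> \<le> (x t)\<^sup>2 + (y t)\<^sup>2"
      using sum_squares_bound[of "\<bar>x t\<bar>" "\<bar>y t\<bar>"] by simp
    finally have "c * (2 * f t) \<le> c * ((x t)\<^sup>2 + (y t)\<^sup>2)" using c by (intro mult_left_mono) auto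
    with f' show "2 * c * f t \<le> f' t" by (simp add: algebra_simps)
    have "0 \<le> c * ((x t)\<^sup>2 + (y t)\<^sup>2)" using c by simp
    with f' show "0 \<le> f' t" by linarith
  qed
  have f0: "f 0 = r\<^sup>2" using \<sigma> by (simp add: f_def x_def y_def p_def power2_eq_square algebra_simps)
  have f_ge: "r\<^sup>2 \<le> f t" if "0 \<le> t" for t
    using DERIV_nonneg_imp_nondecreasing[OF that, of f] der grow f0 by metis
  \<comment> \<open>\<open>f\<close> never drops below \<open>r\<^sup>2\<close>, so it grows at rate
    at least \<open>2 * c * r\<^sup>2\<close>, whereas the supposed stability confines it to
    \<open>c\<^sup>2\<close>. The time used at the end makes the left side
    \<open>c\<^sup>2 + 1\<close>.\<close>
  have "2 * c * r\<^sup>2 * t \<le> c\<^sup>2" if "0 \<le> t" for t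
  proof -
    have "f 0 - 2 * c * r\<^sup>2 * 0 \<le> f t - 2 * c * r\<^sup>2 * t"
    proof (rule DERIV_nonneg_imp_nondecreasing[OF that])
      fix s :: real assume s: "0 \<le> s"
      have "((\<lambda>s. f s - 2 * c * r\<^sup>2 * s) has_real_derivative f' s - 2 * c * r\<^sup>2) (at s)"
        by (auto intro!: derivative_eq_intros der)
      moreover have "2 * c * r\<^sup>2 \<le> 2 * c * f s" using f_ge[OF s] c by simp
      then have "0 \<le> f' s - 2 * c * r\<^sup>2" using grow(1)[OF s] by linarith
      ultimately show "\<exists>y. ((\<lambda>s. f s - 2 * c * r\<^sup>2 * s) has_real_derivative y) (at s) \<and> 0 \<le> y" by blast
    qed
    then have "2 * c * r\<^sup>2 * t \<le> f t - r\<^sup>2" by (simp add: f0)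
    also have "\<dots> \<le> \<bar>f t\<bar>" using zero_le_power2[of r] by linarith
    also have "\<dots> = \<bar>x t\<bar> * \<bar>y t\<bar>" using \<sigma> by (simp add: f_def abs_mult)
    also have "\<dots> \<le> c * c" using near'[OF that] by (intro mult_mono) auto
    finally show ?thesis by (simp add: power2_eq_square)
  qed
  from this[of "(c\<^sup>2 + 1) / (2 * c * r\<^sup>2)"] show False
    using c d(1) by (simp add: r_def)
qed simp

section \<open>Angular motion\<close>

text \<open>A function that starts at a polar angle and has the angular velocity as derivative
  remains a polar angle. In the proof \<open>P\<close> and \<open>E\<close> are the cosine and sine
  of \<open>\<Theta>\<close> minus the polar angle, and both turn out constant.\<close>

lemma polar_representation:
  fixes X Y \<Theta> :: "real \<Rightarrow> real"
  assumes X: "\<And>t. (X has_real_derivative X' t) (at t)"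
    and Y: "\<And>t. (Y has_real_derivative Y' t) (at t)"
    and \<Theta>: "\<And>t. (\<Theta> has_real_derivative (X t * Y' t - Y t * X' t) / ((X t)\<^sup>2 + (Y t)\<^sup>2)) (at t)"
    and pos: "\<And>t. 0 < (X t)\<^sup>2 + (Y t)\<^sup>2"
    and X0: "X 0 = sqrt ((X 0)\<^sup>2 + (Y 0)\<^sup>2) * cos (\<Theta> 0)"
    and Y0: "Y 0 = sqrt ((X 0)\<^sup>2 + (Y 0)\<^sup>2) * sin (\<Theta> 0)"
  shows "X t = sqrt ((X t)\<^sup>2 + (Y t)\<^sup>2) * cos (\<Theta> t)"
    "Y t = sqrt ((X t)\<^sup>2 + (Y t)\<^sup>2) * sin (\<Theta> t)"
proof -
  define R where "R t = sqrt ((X t)\<^sup>2 + (Y t)\<^sup>2)" for t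
  \<comment> \<open>The velocity splits into \<open>h\<close> times the position and
    \<open>\<Omega>\<close> times the position turned by a right angle. Then \<open>R\<close> and
    the numerators of \<open>P\<close> and \<open>E\<close> all satisfy u' = h u, so the quotients
    have derivative 0.\<close>
  define h where "h t = (X t * X' t + Y t * Y' t) / ((X t)\<^sup>2 + (Y t)\<^sup>2)" for t
  define \<Omega> where "\<Omega> t = (X t * Y' t - Y t * X' t) / ((X t)\<^sup>2 + (Y t)\<^sup>2)" for t
  have R: "0 < R t" "R t * R t = (X t)\<^sup>2 + (Y t)\<^sup>2" for t
    using pos[of t] by (auto simp: R_def)
  have X': "X' t = h t * X t - \<Omega> t * Y t" and Y': "Y' t = h t * Y t + \<Omega> t * X t" for t
  proof -
    have N: "(X t)\<^sup>2 + (Y t)\<^sup>2 \<noteq> 0" using pos[of t] by linarith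
    have "h t * ((X t)\<^sup>2 + (Y t)\<^sup>2) = X t * X' t + Y t * Y' t"
      "\<Omega> t * ((X t)\<^sup>2 + (Y t)\<^sup>2) = X t * Y' t - Y t * X' t"
      using N by (simp_all add: h_def \<Omega>_def)
    then have "((X t)\<^sup>2 + (Y t)\<^sup>2) * X' t = ((X t)\<^sup>2 + (Y t)\<^sup>2) * (h t * X t - \<Omega> t * Y t)"
      "((X t)\<^sup>2 + (Y t)\<^sup>2) * Y' t = ((X t)\<^sup>2 + (Y t)\<^sup>2) * (h t * Y t + \<Omega> t * X t)"
      by algebra+
    then show "X' t = h t * X t - \<Omega> t * Y t" "Y' t = h t * Y t + \<Omega> t * X t"
      using N by (simp_all only: mult_cancel_left) auto
  qed
  have dR: "(R has_real_derivative h t * R t) (at t)" for t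
  proof -
    have "(R has_real_derivative (inverse (R t) / 2) * (2 * X t * X' t + 2 * Y t * Y' t)) (at t)"
      unfolding R_def[abs_def]
      by (rule DERIV_chain2, rule DERIV_real_sqrt[OF pos]) (auto intro!: derivative_eq_intros X Y)
    also have "(inverse (R t) / 2) * (2 * X t * X' t + 2 * Y t * Y' t) = inverse (R t) * (h t * (R t * R t))"
    proof -
      have "(X t)\<^sup>2 + (Y t)\<^sup>2 \<noteq> 0" using pos[of t] by linarith
      then have "h t * (R t * R t) = X t * X' t + Y t * Y' t" unfolding R(2) by (simp add: h_def)
      then show ?thesis by (simp add: algebra_simps)
    qed
    also have "\<dots> = h t * R t" using R(1)[of t] by simp
    finally show ?thesis .
  qed
  define P where "P t = (X t * cos (\<Theta> t) + Y t * sin (\<Theta> t)) / R t" for t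
  define E where "E t = (X t * sin (\<Theta> t) - Y t * cos (\<Theta> t)) / R t" for t
  have "(P has_real_derivative 0) (at t)" for t
  proof -
    have n: "((\<lambda>t. X t * cos (\<Theta> t) + Y t * sin (\<Theta> t)) has_real_derivative
        h t * (X t * cos (\<Theta> t) + Y t * sin (\<Theta> t))) (at t)"
      by (auto intro!: derivative_eq_intros X Y \<Theta>[folded \<Omega>_def] simp: X' Y' algebra_simps)
    show ?thesis unfolding P_def[abs_def]
      by (rule DERIV_cong[OF DERIV_divide[OF n dR]]) (use R(1)[of t] in auto)
  qed
  then have P: "P t = P 0" for t by (rule constant_if_zero_derivative)
  have "(E has_real_derivative 0) (at t)" for t
  proof -
    have n: "((\<lambda>t. X t * sin (\<Theta> t) - Y t * cos (\<Theta> t)) has_real_derivative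
        h t * (X t * sin (\<Theta> t) - Y t * cos (\<Theta> t))) (at t)"
      by (auto intro!: derivative_eq_intros X Y \<Theta>[folded \<Omega>_def] simp: X' Y' algebra_simps)
    show ?thesis unfolding E_def[abs_def]
      by (rule DERIV_cong[OF DERIV_divide[OF n dR]]) (use R(1)[of t] in auto)
  qed
  then have E: "E t = E 0" for t by (rule constant_if_zero_derivative)
  have XY0: "X 0 = R 0 * cos (\<Theta> 0)" "Y 0 = R 0 * sin (\<Theta> 0)" using X0 Y0 by (simp_all add: R_def)
  have sc: "cos a * cos a + sin a * sin a = 1" for a :: real
    using sin_cos_squared_add3 by blast
  have "P 0 = R 0 * (cos (\<Theta> 0) * cos (\<Theta> 0) + sin (\<Theta> 0) * sin (\<Theta> 0)) / R 0"
    unfolding P_def XY0 by (simp only: distrib_left mult.assoc)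
  then have "P 0 = 1" using R(1)[of 0] by (simp add: sc)
  moreover have "E 0 = 0" unfolding E_def XY0 by simp
  ultimately have PE: "X t * cos (\<Theta> t) + Y t * sin (\<Theta> t) = R t" "X t * sin (\<Theta> t) - Y t * cos (\<Theta> t) = 0"
    using P[of t] E[of t] R(1)[of t] by (simp_all add: P_def E_def)
  have "X t = X t * (cos (\<Theta> t) * cos (\<Theta> t) + sin (\<Theta> t) * sin (\<Theta> t))" by (simp add: sc)
  also have "\<dots> = (X t * cos (\<Theta> t) + Y t * sin (\<Theta> t)) * cos (\<Theta> t)
      + (X t * sin (\<Theta> t) - Y t * cos (\<Theta> t)) * sin (\<Theta> t)" by algebra
  finally show "X t = sqrt ((X t)\<^sup>2 + (Y t)\<^sup>2) * cos (\<Theta> t)"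
    unfolding PE by (simp add: R_def)
  have "Y t = Y t * (cos (\<Theta> t) * cos (\<Theta> t) + sin (\<Theta> t) * sin (\<Theta> t))" by (simp add: sc)
  also have "\<dots> = (X t * cos (\<Theta> t) + Y t * sin (\<Theta> t)) * sin (\<Theta> t)
      - (X t * sin (\<Theta> t) - Y t * cos (\<Theta> t)) * cos (\<Theta> t)" by algebra
  finally show "Y t = sqrt ((X t)\<^sup>2 + (Y t)\<^sup>2) * sin (\<Theta> t)"
    unfolding PE by (simp add: R_def)
qed

section \<open>Level and polar angle as coordinates on the surface\<close>

definition radius2 :: "real \<Rightarrow> real \<Rightarrow> real^3 \<Rightarrow> real" where
  "radius2 \<beta> M p = (1 - M / \<beta>) * (p$1)\<^sup>2 + (1 + M / \<beta>) * (p$2)\<^sup>2"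

text \<open>A relation rather than a function, because the angle accumulates along an orbit and is
  not reduced modulo 2 pi.\<close>

definition has_angle :: "real \<Rightarrow> real \<Rightarrow> real^3 \<Rightarrow> real \<Rightarrow> bool" where
  "has_angle \<beta> M p \<theta> \<longleftrightarrow> sqrt (1 - M / \<beta>) * p$1 = sqrt (radius2 \<beta> M p) * cos \<theta>
     \<and> sqrt (1 + M / \<beta>) * p$2 = sqrt (radius2 \<beta> M p) * sin \<theta>"

lemma ratio_pos:
  fixes M \<beta> :: real
  assumes "\<bar>M\<bar> < \<bar>\<beta>\<bar>"
  shows "0 < 1 - M / \<beta>" "0 < 1 + M / \<beta>"
  using abs_ratio_less_1[OF assms] by linarith+

lemma radius2_eq:
  assumes "\<bar>M\<bar> < \<bar>\<beta>\<bar>"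
  shows "radius2 \<beta> M p = (sqrt (1 - M / \<beta>) * p$1)\<^sup>2 + (sqrt (1 + M / \<beta>) * p$2)\<^sup>2"
  using ratio_pos[OF assms] by (simp add: radius2_def power_mult_distrib)

lemma lyap_eq_radius2: "lyap \<beta> M p = radius2 \<beta> M p + 2 * (p$3 - M)\<^sup>2"
  by (simp add: lyap_def radius2_def)

lemma has_angle_exists:
  assumes "\<bar>M\<bar> < \<bar>\<beta>\<bar>"
  shows "\<exists>\<theta>. has_angle \<beta> M p \<theta>"
proof -
  obtain r \<theta> where r: "sqrt (1 - M / \<beta>) * p$1 = r * cos \<theta>" "sqrt (1 + M / \<beta>) * p$2 = r * sin \<theta>"
    using polar_Ex by blast
  \<comment> \<open>\<open>polar_Ex\<close> does not fix the sign of \<open>r\<close>; a negative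
    radius is absorbed by half a turn.\<close>
  define \<theta>' where "\<theta>' = (if 0 \<le> r then \<theta> else \<theta> + pi)"
  have "radius2 \<beta> M p = r\<^sup>2 * ((cos \<theta>)\<^sup>2 + (sin \<theta>)\<^sup>2)"
    unfolding radius2_eq[OF assms] r power_mult_distrib distrib_left ..
  then have "sqrt (radius2 \<beta> M p) = \<bar>r\<bar>" by simp
  then have "has_angle \<beta> M p \<theta>'" by (simp add: has_angle_def r \<theta>'_def)
  then show ?thesis ..
qed

text \<open>Along a ray in the rescaled plane, \<open>lyap = R^2 + const * R^4\<close> is strictly increasing.\<close>
lemma same_level_same_angle:
  assumes "\<beta> \<noteq> 0" "\<bar>M\<bar> < \<bar>\<beta>\<bar>" "p \<in> Sig \<beta> (- \<beta> * M)" "q \<in> Sig \<beta> (- \<beta> * M)"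
    and "lyap \<beta> M p = lyap \<beta> M q" "has_angle \<beta> M p \<theta>" "has_angle \<beta> M q \<theta>"
  shows "p = q"
proof -
  define a b where "a = 1 - M / \<beta>" and "b = 1 + M / \<beta>"
  have ab: "0 < a" "0 < b" using ratio_pos[OF assms(2)] by (simp_all add: a_def b_def)
  \<comment> \<open>On the ray with angle \<theta> the height difference \<open>z - M\<close> is a
    constant times \<open>radius2\<close>; \<open>K\<close> is twice the square of that
    constant.\<close>
  define K where "K = 2 * (((sin \<theta> / sqrt b)\<^sup>2 - (cos \<theta> / sqrt a)\<^sup>2) / (4 * \<beta>))\<^sup>2"
  have coords: "v$1 = sqrt (radius2 \<beta> M v) * (cos \<theta> / sqrt a)" "v$2 = sqrt (radius2 \<beta> M v) * (sin \<theta> / sqrt b)"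
    if "has_angle \<beta> M v \<theta>" for v
    using that ab unfolding has_angle_def a_def[symmetric] b_def[symmetric] by (auto simp: field_simps)
  have nonneg: "0 \<le> radius2 \<beta> M v" for v
    using radius2_eq[OF assms(2)] by simp
  have z: "v$3 - M = radius2 \<beta> M v * (((sin \<theta> / sqrt b)\<^sup>2 - (cos \<theta> / sqrt a)\<^sup>2) / (4 * \<beta>))"
    if "has_angle \<beta> M v \<theta>" "v \<in> Sig \<beta> (- \<beta> * M)" for v
  proof -
    have "v$3 - M = ((v$2)\<^sup>2 - (v$1)\<^sup>2) / (4 * \<beta>)"
      using that(2) unfolding mem_Sig[OF assms(1)] by simp
    also have "(v$2)\<^sup>2 - (v$1)\<^sup>2 = radius2 \<beta> M v * ((sin \<theta> / sqrt b)\<^sup>2 - (cos \<theta> / sqrt a)\<^sup>2)"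
      unfolding coords[OF that(1)] power_mult_distrib real_sqrt_pow2[OF nonneg] by (simp only: right_diff_distrib)
    finally show ?thesis by simp
  qed
  have lv: "lyap \<beta> M v = radius2 \<beta> M v + K * (radius2 \<beta> M v)\<^sup>2"
    if "has_angle \<beta> M v \<theta>" "v \<in> Sig \<beta> (- \<beta> * M)" for v
    unfolding lyap_eq_radius2 z[OF that] K_def power_mult_distrib by simp
  have K: "0 \<le> K" by (simp add: K_def)
  have "radius2 \<beta> M p = radius2 \<beta> M q"
  proof (rule ccontr)
    have less: "s + K * s\<^sup>2 < t + K * t\<^sup>2" if "0 \<le> s" "s < t" for s t
      using that K by (intro add_less_le_mono mult_left_mono power_mono) auto
    assume "radius2 \<beta> M p \<noteq> radius2 \<beta> M q"
    then show False
      using less[OF nonneg, of p "radius2 \<beta> M q"] less[OF nonneg, of q "radius2 \<beta> M p"]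
        assms(5) lv[OF assms(6,3)] lv[OF assms(7,4)] by linarith
  qed
  then have "p$1 = q$1" "p$2 = q$2" "p$3 = q$3"
    using coords[OF assms(6)] coords[OF assms(7)] z[OF assms(6,3)] z[OF assms(7,4)] by simp_all
  then show ?thesis by (simp add: vec_eq_iff forall_3)
qed

text \<open>The vertical axis meets the surface only at the equilibrium, where \<open>lyap\<close>
  vanishes. So an orbit at a positive level never passes over the origin and its angle is well
  defined modulo 2 pi.\<close>

lemma radius2_pos:
  assumes "\<beta> \<noteq> 0" "\<bar>M\<bar> < \<bar>\<beta>\<bar>" "p \<in> Sig \<beta> (- \<beta> * M)" "0 < lyap \<beta> M p"
  shows "0 < radius2 \<beta> M p"
proof (rule ccontr)
  assume "\<not> 0 < radius2 \<beta> M p"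
  moreover have "0 < (1 - M / \<beta>) * (p$1)\<^sup>2 + (1 + M / \<beta>) * (p$2)\<^sup>2" if "p$1 \<noteq> 0 \<or> p$2 \<noteq> 0"
    using that ratio_pos[OF assms(2)] by (auto intro: add_pos_nonneg add_nonneg_pos)
  ultimately have "p$1 = 0" "p$2 = 0" by (auto simp: radius2_def)
  with assms(3)[unfolded mem_Sig[OF assms(1)]] assms(4) show False by (simp add: lyap_def)
qed

text \<open>The signed angular speed of the linearized motion, which becomes a uniform rotation once
  the coordinates are rescaled by the two square roots.\<close>

definition freq :: "real \<Rightarrow> real \<Rightarrow> real" where
  "freq \<beta> M = - \<beta> * sqrt (1 - M / \<beta>) * sqrt (1 + M / \<beta>)"

lemma abs_freq:
  assumes "\<beta> \<noteq> 0" "\<bar>M\<bar> < \<bar>\<beta>\<bar>"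
  shows "\<bar>freq \<beta> M\<bar> = sqrt (\<beta>\<^sup>2 - M\<^sup>2)"
proof -
  have "\<bar>freq \<beta> M\<bar> = sqrt (\<beta>\<^sup>2 * ((1 - M / \<beta>) * (1 + M / \<beta>)))"
    using ratio_pos[OF assms(2)] by (simp add: freq_def abs_mult real_sqrt_mult)
  also have "\<beta>\<^sup>2 * ((1 - M / \<beta>) * (1 + M / \<beta>)) = \<beta>\<^sup>2 - M\<^sup>2"
    using assms(1) by (simp add: field_simps power2_eq_square)
  finally show ?thesis .
qed

text \<open>In the rescaled plane every orbit winds around the origin with angular speed
  \<open>freq * (1 + g)\<close>, where \<open>g\<close> is nonnegative and of the order of the level; \<open>\<tau>\<close> is the
  antiderivative of \<open>1 + g\<close>.\<close>
lemma flow_angle: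
  assumes "\<beta> \<noteq> 0" "\<bar>M\<bar> < \<bar>\<beta>\<bar>" "p \<in> Sig \<beta> (- \<beta> * M)" "0 < lyap \<beta> M p"
  defines "C \<equiv> 1 / (4 * \<beta>\<^sup>2 * (1 - \<bar>M / \<beta>\<bar>)\<^sup>2)"
  obtains \<tau> \<tau>' \<theta> where "\<tau> 0 = 0" "\<And>t. (\<tau> has_real_derivative \<tau>' t) (at t)"
    "\<And>t. 1 \<le> \<tau>' t" "\<And>t. \<tau>' t \<le> 1 + C * lyap \<beta> M p"
    "\<And>t. has_angle \<beta> M (flow (Xb \<beta>) t p) (\<theta> + freq \<beta> M * \<tau> t)"
proof -
  define \<phi> where "\<phi> t = flow (Xb \<beta>) t p" for t
  \<comment> \<open>On the surface the numerator is
    \<open>16 * \<beta>\<^sup>2 * (z - M)\<^sup>2\<close>, so \<open>g\<close> is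
    \<open>4 * (z - M)\<^sup>2 / radius2\<close>: the effect of the varying height on the angular
    speed.\<close>
  define g where "g t = (((\<phi> t)$2)\<^sup>2 - ((\<phi> t)$1)\<^sup>2)\<^sup>2 / (4 * \<beta>\<^sup>2 * radius2 \<beta> M (\<phi> t))" for t
  have Sig: "\<phi> t \<in> Sig \<beta> (- \<beta> * M)" for t
    using flow_Sig[OF assms(3)] by (simp add: \<phi>_def)
  have lyap: "lyap \<beta> M (\<phi> t) = lyap \<beta> M p" for t
    by (simp add: \<phi>_def lyap_conserved assms(1))
  have pos: "0 < radius2 \<beta> M (\<phi> t)" for t
    using radius2_pos[OF assms(1,2) Sig] lyap assms(4) by simp
  have "continuous_on UNIV \<phi>"
    unfolding \<phi>_def[abs_def] using flow_has_vector_derivative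
    by (auto intro!: continuous_at_imp_continuous_on has_vector_derivative_continuous)
  then have "continuous_on UNIV (\<lambda>t. 1 + g t)"
    unfolding g_def[abs_def]
    by (intro continuous_intros) (use pos assms(1) in \<open>auto simp: radius2_def less_imp_neq[symmetric] intro!: continuous_intros\<close>)
  then obtain \<tau> where \<tau>: "\<tau> 0 = 0" "\<And>t. (\<tau> has_vector_derivative 1 + g t) (at t)"
    using continuous_antiderivative by blast
  have d\<tau>: "(\<tau> has_real_derivative 1 + g t) (at t)" for t
    using \<tau>(2) by (simp add: has_real_derivative_iff_has_vector_derivative)
  define \<kappa> where "\<kappa> = 1 - \<bar>M / \<beta>\<bar>"
  have \<kappa>: "0 < \<kappa>" using abs_ratio_less_1[OF assms(2)] by (simp add: \<kappa>_def)
  have g: "0 \<le> g t" "g t \<le> C * lyap \<beta> M p" for t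
  proof -
    define r where "r = radius2 \<beta> M (\<phi> t)"
    define x y where "x = \<phi> t $ 1" and "y = \<phi> t $ 2"
    have r: "0 < r" "r \<le> lyap \<beta> M p"
      using pos[of t] lyap[of t] zero_le_power2[of "\<phi> t $ 3 - M"]
      unfolding r_def lyap_eq_radius2[of \<beta> M "\<phi> t"] by linarith+
    show "0 \<le> g t" using pos[of t] by (simp add: g_def)
    \<comment> \<open>Origin of \<open>C\<close>: the numerator of \<open>g\<close> is at most
      \<open>(x\<^sup>2 + y\<^sup>2)\<^sup>2\<close>, hence at most
      \<open>(r / \<kappa>)\<^sup>2\<close>, and one factor \<open>r\<close> cancels against the
      denominator while the other is bounded by the level.\<close>
    have "\<kappa> * (x\<^sup>2 + y\<^sup>2) \<le> r"
      unfolding r_def radius2_def \<kappa>_def x_def y_def by (rule quadratic_part_ge)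
    then have "(\<kappa> * (x\<^sup>2 + y\<^sup>2))\<^sup>2 \<le> r\<^sup>2" using \<kappa> by (intro power_mono) auto
    moreover have "(y\<^sup>2 - x\<^sup>2)\<^sup>2 \<le> (x\<^sup>2 + y\<^sup>2)\<^sup>2"
      by (rule abs_le_square_iff[THEN iffD1]) (simp add: abs_le_iff)
    ultimately have "\<kappa>\<^sup>2 * (y\<^sup>2 - x\<^sup>2)\<^sup>2 \<le> r * r"
      using mult_left_mono[of "(y\<^sup>2 - x\<^sup>2)\<^sup>2" "(x\<^sup>2 + y\<^sup>2)\<^sup>2" "\<kappa>\<^sup>2"]
      by (simp add: power_mult_distrib flip: power2_eq_square)
    also have "\<dots> \<le> r * lyap \<beta> M p" using r by (intro mult_left_mono) auto
    finally have "(y\<^sup>2 - x\<^sup>2)\<^sup>2 \<le> r * lyap \<beta> M p / \<kappa>\<^sup>2" using \<kappa> by (simp add: field_simps)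
    then have "g t \<le> (r * lyap \<beta> M p / \<kappa>\<^sup>2) / (4 * \<beta>\<^sup>2 * r)"
      unfolding g_def r_def[symmetric] x_def[symmetric] y_def[symmetric]
      using r by (intro divide_right_mono) auto
    also have "\<dots> = C * lyap \<beta> M p"
      using r by (simp add: C_def \<kappa>_def)
    finally show "g t \<le> C * lyap \<beta> M p" .
  qed
  obtain \<theta> where \<theta>: "has_angle \<beta> M p \<theta>" using has_angle_exists[OF assms(2)] by blast
  define X Y where "X t = sqrt (1 - M / \<beta>) * \<phi> t $ 1" and "Y t = sqrt (1 + M / \<beta>) * \<phi> t $ 2" for t
  define X' Y' where "X' t = sqrt (1 - M / \<beta>) * (\<phi> t $ 2 * (\<phi> t $ 3 + \<beta>))"
    and "Y' t = sqrt (1 + M / \<beta>) * (\<phi> t $ 1 * (\<phi> t $ 3 - \<beta>))" for t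
  have dX: "(X has_real_derivative X' t) (at t)" and dY: "(Y has_real_derivative Y' t) (at t)" for t
    unfolding X_def[abs_def] X'_def Y_def[abs_def] Y'_def \<phi>_def
    by (intro DERIV_cmult flow_coordinates)+
  have r2: "(X t)\<^sup>2 + (Y t)\<^sup>2 = radius2 \<beta> M (\<phi> t)" for t
    unfolding radius2_eq[OF assms(2)] X_def Y_def ..
  have ang: "X t * Y' t - Y t * X' t = freq \<beta> M * (1 + g t) * radius2 \<beta> M (\<phi> t)" for t
  proof -
    define x y z where "x = \<phi> t $ 1" and "y = \<phi> t $ 2" and "z = \<phi> t $ 3"
    have z: "z = M + (y\<^sup>2 - x\<^sup>2) / (4 * \<beta>)"
      using Sig[of t] unfolding mem_Sig[OF assms(1)] x_def y_def z_def .
    have "X t * Y' t - Y t * X' t = sqrt (1 - M / \<beta>) * sqrt (1 + M / \<beta>) * (x\<^sup>2 * (z - \<beta>) - y\<^sup>2 * (z + \<beta>))"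
      by (simp add: X_def Y_def X'_def Y'_def x_def y_def z_def algebra_simps power2_eq_square)
    also have "x\<^sup>2 * (z - \<beta>) - y\<^sup>2 * (z + \<beta>) =
        - \<beta> * ((1 - M / \<beta>) * x\<^sup>2 + (1 + M / \<beta>) * y\<^sup>2 + (y\<^sup>2 - x\<^sup>2)\<^sup>2 / (4 * \<beta>\<^sup>2))"
      unfolding z using assms(1) by (simp add: field_simps power2_eq_square)
    also have "(1 - M / \<beta>) * x\<^sup>2 + (1 + M / \<beta>) * y\<^sup>2 + (y\<^sup>2 - x\<^sup>2)\<^sup>2 / (4 * \<beta>\<^sup>2) =
        (1 + g t) * radius2 \<beta> M (\<phi> t)"
    proof -
      have "g t * radius2 \<beta> M (\<phi> t) = (y\<^sup>2 - x\<^sup>2)\<^sup>2 / (4 * \<beta>\<^sup>2)"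
        using pos[of t] by (simp add: g_def x_def y_def)
      moreover have "(1 - M / \<beta>) * x\<^sup>2 + (1 + M / \<beta>) * y\<^sup>2 = radius2 \<beta> M (\<phi> t)"
        by (simp add: radius2_def x_def y_def)
      ultimately show ?thesis by (simp only: distrib_right[of 1 "g t"] mult_1_left)
    qed
    finally show ?thesis by (simp add: freq_def algebra_simps)
  qed
  have d\<Theta>: "((\<lambda>t. \<theta> + freq \<beta> M * \<tau> t) has_real_derivative
      (X t * Y' t - Y t * X' t) / ((X t)\<^sup>2 + (Y t)\<^sup>2)) (at t)" for t
  proof -
    have "(X t * Y' t - Y t * X' t) / ((X t)\<^sup>2 + (Y t)\<^sup>2) = freq \<beta> M * (1 + g t)"
      unfolding r2 ang using pos[of t] by simp
    then show ?thesis by (auto intro!: derivative_eq_intros d\<tau>)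
  qed
  have "\<phi> 0 = p" by (simp add: \<phi>_def)
  then have init: "X 0 = sqrt ((X 0)\<^sup>2 + (Y 0)\<^sup>2) * cos (\<theta> + freq \<beta> M * \<tau> 0)"
    "Y 0 = sqrt ((X 0)\<^sup>2 + (Y 0)\<^sup>2) * sin (\<theta> + freq \<beta> M * \<tau> 0)"
    unfolding r2 using \<theta> by (simp_all add: has_angle_def X_def Y_def \<tau>(1))
  have "has_angle \<beta> M (\<phi> t) (\<theta> + freq \<beta> M * \<tau> t)" for t
    using polar_representation[OF dX dY d\<Theta> _ init, of t] pos
    unfolding r2 by (simp add: has_angle_def X_def Y_def)
  then show thesis
    using that[of \<tau> "\<lambda>t. 1 + g t" \<theta>] \<tau>(1) d\<tau> g by (simp add: \<phi>_def)
qed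

section \<open>Periodic orbits\<close>

definition level :: "real \<Rightarrow> real \<Rightarrow> real \<Rightarrow> (real^3) set" where
  "level \<beta> M \<epsilon> = {p \<in> Sig \<beta> (- \<beta> * M). lyap \<beta> M p = \<epsilon>}"

text \<open>The ray from the origin through the horizontal projection of \<open>q\<close>, lifted to
  the surface.\<close>

definition ray :: "real \<Rightarrow> real \<Rightarrow> real^3 \<Rightarrow> real \<Rightarrow> real^3" where
  "ray \<beta> M q s = vector [s * q$1, s * q$2, M + s\<^sup>2 * (((q$2)\<^sup>2 - (q$1)\<^sup>2) / (4 * \<beta>))]"

lemma continuous_on_ray: "continuous_on S (ray \<beta> M q)"
proof -
  have "\<forall>i. continuous_on S (\<lambda>s. ray \<beta> M q s $ i)"
    unfolding forall_3 ray_def vector_3 by (intro conjI continuous_intros)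
  then show ?thesis using continuous_on_vec_lambda[of S "\<lambda>i s. ray \<beta> M q s $ i"] by simp
qed

lemma ray_in_Sig: "\<beta> \<noteq> 0 \<Longrightarrow> ray \<beta> M q s \<in> Sig \<beta> (- \<beta> * M)"
  unfolding mem_Sig by (simp add: ray_def power_mult_distrib flip: right_diff_distrib)

lemma ray_0: "ray \<beta> M q 0 = vector [0, 0, M]"
  by (simp add: ray_def)

lemma ray_1:
  assumes "\<beta> \<noteq> 0" "q \<in> Sig \<beta> (- \<beta> * M)"
  shows "ray \<beta> M q 1 = q"
  using assms(2)[unfolded mem_Sig[OF assms(1)]] by (simp add: ray_def vec_eq_iff forall_3)

text \<open>For \<bar>M\<bar> < \<bar>\<beta>\<bar> both coefficients are nonnegative, so
  \<open>lyap\<close> does not decrease as \<open>s\<close> grows from 0. This yields points on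
  every level and star-shaped sublevel sets.\<close>

lemma lyap_ray:
  "lyap \<beta> M (ray \<beta> M q s) =
     s\<^sup>2 * radius2 \<beta> M q + s ^ 4 * (2 * (((q$2)\<^sup>2 - (q$1)\<^sup>2) / (4 * \<beta>))\<^sup>2)"
proof -
  have "s ^ 4 = (s\<^sup>2)\<^sup>2" by simp
  then show ?thesis
    by (simp only: lyap_def radius2_def ray_def vector_3 power_mult_distrib add_diff_cancel_left'
        distrib_left mult.left_commute)
qed

lemma level_nonempty:
  assumes "\<beta> \<noteq> 0" "\<bar>M\<bar> < \<bar>\<beta>\<bar>" "0 < \<epsilon>"
  shows "level \<beta> M \<epsilon> \<noteq> {}"
proof -
  define e1 :: "real^3" where "e1 = axis 1 1"
  define a where "a = 1 - M / \<beta>"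
  have a: "0 < a" using ratio_pos[OF assms(2)] by (simp add: a_def)
  \<comment> \<open>Here the quadratic term alone already reaches \<epsilon>, so the intermediate
    value theorem applies on \<open>{0..s}\<close>.\<close>
  define s where "s = sqrt (\<epsilon> / a)"
  have s: "0 \<le> s" "s\<^sup>2 = \<epsilon> / a" using a assms(3) by (simp_all add: s_def)
  have "radius2 \<beta> M e1 = a" by (simp add: radius2_def e1_def a_def axis_def)
  then have "\<epsilon> \<le> lyap \<beta> M (ray \<beta> M e1 s)"
    unfolding lyap_ray using s a by simp
  moreover have "lyap \<beta> M (ray \<beta> M e1 0) \<le> \<epsilon>" using assms(3) by (simp add: ray_0)
  moreover have "continuous_on {0..s} (\<lambda>s. lyap \<beta> M (ray \<beta> M e1 s))"
    by (rule continuous_on_compose2[OF continuous_on_lyap[of UNIV] continuous_on_ray]) simp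
  ultimately obtain r where "lyap \<beta> M (ray \<beta> M e1 r) = \<epsilon>"
    using IVT'[of "\<lambda>s. lyap \<beta> M (ray \<beta> M e1 s)" 0 \<epsilon> s] s(1) by blast
  then have "ray \<beta> M e1 r \<in> level \<beta> M \<epsilon>"
    using ray_in_Sig[OF assms(1)] by (simp add: level_def)
  then show ?thesis by blast
qed

lemma derivative_bounds_linear:
  fixes \<tau> :: "real \<Rightarrow> real"
  assumes d: "\<And>t. (\<tau> has_real_derivative \<tau>' t) (at t)" and b: "\<And>t. l \<le> \<tau>' t" "\<And>t. \<tau>' t \<le> u"
    and "s \<le> t"
  shows "l * (t - s) \<le> \<tau> t - \<tau> s" "\<tau> t - \<tau> s \<le> u * (t - s)"
proof -
  have "\<exists>y. ((\<lambda>t. \<tau> t - l * t) has_real_derivative y) (at r) \<and> 0 \<le> y" for r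
    by (rule exI[of _ "\<tau>' r - l"]) (use b in \<open>auto intro!: derivative_eq_intros d\<close>)
  then have "\<tau> s - l * s \<le> \<tau> t - l * t"
    using DERIV_nonneg_imp_nondecreasing[OF \<open>s \<le> t\<close>, of "\<lambda>t. \<tau> t - l * t"] by simp
  then show "l * (t - s) \<le> \<tau> t - \<tau> s" by (simp add: right_diff_distrib)
  have "\<exists>y. ((\<lambda>t. \<tau> t - u * t) has_real_derivative y) (at r) \<and> y \<le> 0" for r
    by (rule exI[of _ "\<tau>' r - u"]) (use b in \<open>auto intro!: derivative_eq_intros d\<close>)
  then have "\<tau> t - u * t \<le> \<tau> s - u * s"
    using DERIV_nonpos_imp_nonincreasing[OF \<open>s \<le> t\<close>, of "\<lambda>t. \<tau> t - u * t"] by simp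
  then show "\<tau> t - \<tau> s \<le> u * (t - s)" by (simp add: right_diff_distrib)
qed

text \<open>By \<open>same_level_same_angle\<close> a point of the level is known from its angle. As
  \<tau> is onto, the orbit meets every angle and hence every point of the level; as \<tau> is
  strictly increasing, the first return is the time \<open>T\<close> at which it reaches the linear
  period \<open>T0\<close>. The bounds on the derivative of \<tau> then compare \<open>T\<close>
  with \<open>T0\<close>.\<close>

lemma level_periodic_orbit:
  assumes "\<beta> \<noteq> 0" "\<bar>M\<bar> < \<bar>\<beta>\<bar>" "0 < \<epsilon>"
  defines "C \<equiv> 1 / (4 * \<beta>\<^sup>2 * (1 - \<bar>M / \<beta>\<bar>)\<^sup>2)"
  shows "\<exists>T. periodic_orbit (Xb \<beta>) (level \<beta> M \<epsilon>) T \<and> T \<le> 2 * pi / sqrt (\<beta>\<^sup>2 - M\<^sup>2)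
    \<and> 2 * pi / sqrt (\<beta>\<^sup>2 - M\<^sup>2) \<le> (1 + C * \<epsilon>) * T"
proof -
  define \<omega> where "\<omega> = freq \<beta> M"
  define T0 where "T0 = 2 * pi / sqrt (\<beta>\<^sup>2 - M\<^sup>2)"
  have \<omega>: "\<bar>\<omega>\<bar> = sqrt (\<beta>\<^sup>2 - M\<^sup>2)" unfolding \<omega>_def by (rule abs_freq[OF assms(1,2)])
  have "M\<^sup>2 < \<beta>\<^sup>2" using power_strict_mono[OF assms(2), of 2] by simp
  then have \<omega>0: "\<omega> \<noteq> 0" using \<omega> by auto
  have T0: "0 < T0" "\<bar>\<omega>\<bar> * T0 = 2 * pi"
    using \<open>M\<^sup>2 < \<beta>\<^sup>2\<close> unfolding T0_def \<omega> by simp_all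
  obtain p where p: "p \<in> Sig \<beta> (- \<beta> * M)" "lyap \<beta> M p = \<epsilon>"
    using level_nonempty[OF assms(1-3)] by (auto simp: level_def)
  have "0 < lyap \<beta> M p" using p assms(3) by simp
  from flow_angle[OF assms(1,2) p(1) this]
  obtain \<tau> \<tau>' \<theta> where \<tau>: "\<tau> 0 = 0" "\<And>t. (\<tau> has_real_derivative \<tau>' t) (at t)"
    "\<And>t. 1 \<le> \<tau>' t" "\<And>t. \<tau>' t \<le> 1 + C * \<epsilon>"
    and angle: "\<And>t. has_angle \<beta> M (flow (Xb \<beta>) t p) (\<theta> + \<omega> * \<tau> t)"
    unfolding p(2) C_def \<omega>_def by blast
  note lin = derivative_bounds_linear[OF \<tau>(2-4)]
  have cont: "continuous_on S \<tau>" for S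
    using \<tau>(2) DERIV_isCont by (blast intro: continuous_at_imp_continuous_on)
  have surj: "\<exists>t. \<tau> t = v" for v
  proof -
    have "\<tau> (min 0 v) \<le> v" "v \<le> \<tau> (max 0 v)"
      using lin(1)[of "min 0 v" 0] lin(1)[of 0 "max 0 v"] \<tau>(1) by (auto simp: min_def max_def)
    moreover have "min 0 v \<le> max 0 v" by simp
    ultimately show ?thesis using IVT'[of \<tau> "min 0 v" v "max 0 v", OF _ _ _ cont] by blast
  qed
  have mono: "\<tau> s < \<tau> t" if "s < t" for s t
    using lin(1)[of s t] that by simp
  have Sig: "flow (Xb \<beta>) t p \<in> Sig \<beta> (- \<beta> * M)" for t by (rule flow_Sig[OF p(1)])
  have lev: "lyap \<beta> M (flow (Xb \<beta>) t p) = \<epsilon>" for t by (simp add: lyap_conserved assms(1) p(2))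
  have orbit: "q = flow (Xb \<beta>) t p"
    if "q \<in> level \<beta> M \<epsilon>" "has_angle \<beta> M q (\<theta> + \<omega> * \<tau> t)" for q t
    using that Sig[of t] lev[of t] angle[of t]
    by (intro same_level_same_angle[OF assms(1,2)]) (auto simp: level_def)
  have plev: "p \<in> level \<beta> M \<epsilon>" using p by (simp add: level_def)
  have pangle: "has_angle \<beta> M p \<theta>" using angle[of 0] by (simp add: \<tau>(1))
  obtain T where T: "\<tau> T = T0" using surj by blast
  have Tpos: "0 < T"
  proof (rule ccontr)
    assume "\<not> 0 < T"
    then have "\<tau> T \<le> 0" using mono[of T 0] \<tau>(1) by (cases "T = 0") auto
    with T T0 show False by simp
  qed
  have "level \<beta> M \<epsilon> = range (\<lambda>t. flow (Xb \<beta>) t p)"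
  proof (intro equalityI subsetI)
    fix q assume q: "q \<in> level \<beta> M \<epsilon>"
    obtain \<alpha> where \<alpha>: "has_angle \<beta> M q \<alpha>" using has_angle_exists[OF assms(2)] by blast
    obtain t where "\<tau> t = (\<alpha> - \<theta>) / \<omega>" using surj by blast
    then have "\<theta> + \<omega> * \<tau> t = \<alpha>" using \<omega>0 by simp
    then show "q \<in> range (\<lambda>t. flow (Xb \<beta>) t p)" using orbit[OF q, of t] \<alpha> by auto
  qed (use Sig lev in \<open>auto simp: level_def\<close>)
  moreover have "flow (Xb \<beta>) T p = p"
  proof -
    have "\<omega> * \<tau> T = 2 * pi \<or> \<omega> * \<tau> T = - (2 * pi)"
      using T0(2) unfolding T by (cases "0 \<le> \<omega>") auto
    then have "cos (\<theta> + \<omega> * \<tau> T) = cos \<theta>" "sin (\<theta> + \<omega> * \<tau> T) = sin \<theta>"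
      by (auto simp: cos_add sin_add)
    then have "has_angle \<beta> M p (\<theta> + \<omega> * \<tau> T)" using pangle by (simp add: has_angle_def)
    from orbit[OF plev this] show ?thesis ..
  qed
  moreover have "flow (Xb \<beta>) s p \<noteq> p" if s: "s \<in> {0<..<T}" for s
  proof
    assume eq: "flow (Xb \<beta>) s p = p"
    \<comment> \<open>The positive radius can be cancelled, so a return changes the angle by a
      multiple of 2 pi. Before time \<open>T\<close> the change is nonzero and smaller than a full
      turn.\<close>
    have "0 < radius2 \<beta> M p" using radius2_pos[OF assms(1,2) p(1)] p(2) assms(3) by simp
    then have "sin (\<theta> + \<omega> * \<tau> s) = sin \<theta> \<and> cos (\<theta> + \<omega> * \<tau> s) = cos \<theta>"
      using angle[of s] pangle unfolding eq has_angle_def by auto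
    then obtain n :: int where n: "\<theta> + \<omega> * \<tau> s = \<theta> + 2 * pi * n"
      using sin_cos_eq_iff by (metis mult.commute mult.left_commute)
    have \<tau>s: "0 < \<tau> s" "\<tau> s < T0" using mono[of 0 s] mono[of s T] s \<tau>(1) T by auto
    have "\<bar>\<omega>\<bar> * \<tau> s < 2 * pi"
      unfolding T0(2)[symmetric] using \<tau>s \<omega>0 by (intro mult_strict_left_mono) auto
    moreover have "\<bar>\<omega>\<bar> * \<tau> s = 2 * pi * \<bar>real_of_int n\<bar>"
    proof -
      have "\<bar>\<omega> * \<tau> s\<bar> = \<bar>2 * pi * real_of_int n\<bar>" using n by simp
      then show ?thesis using \<tau>s by (simp add: abs_mult)
    qed
    ultimately have "\<bar>real_of_int n\<bar> < 1" by simp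
    then have "n = 0" by linarith
    then show False using n \<omega>0 \<tau>s by simp
  qed
  ultimately have "periodic_orbit (Xb \<beta>) (level \<beta> M \<epsilon>) T"
    unfolding periodic_orbit_def using Tpos by blast
  moreover have "T \<le> T0" "T0 \<le> (1 + C * \<epsilon>) * T"
    using lin[of 0 T] Tpos T \<tau>(1) by simp_all
  ultimately show ?thesis unfolding T0_def by blast
qed

text \<open>A connected set that contains the equilibrium and avoids the value \<epsilon> of
  \<open>lyap\<close> stays below it; conversely a lifted ray joins every point of the sublevel set
  to the equilibrium inside that set.\<close>

lemma connected_component_sublevel:
  assumes "\<beta> \<noteq> 0" "\<bar>M\<bar> < \<bar>\<beta>\<bar>" "0 < \<epsilon>"
  shows "connected_component_set (Sig \<beta> (- \<beta> * M) - level \<beta> M \<epsilon>) (vector [0, 0, M]) =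
    {p \<in> Sig \<beta> (- \<beta> * M). lyap \<beta> M p < \<epsilon>}" (is "?C = ?S")
proof (intro equalityI subsetI)
  fix q assume "q \<in> ?C"
  then obtain A where A: "connected A" "A \<subseteq> Sig \<beta> (- \<beta> * M) - level \<beta> M \<epsilon>" "vector [0, 0, M] \<in> A" "q \<in> A"
    unfolding connected_component_def by blast
  have conn: "connected (lyap \<beta> M ` A)"
    using A(1) by (rule connected_continuous_image[OF continuous_on_lyap])
  have "lyap \<beta> M q < \<epsilon>"
  proof (rule ccontr)
    assume "\<not> lyap \<beta> M q < \<epsilon>"
    moreover have "0 \<in> lyap \<beta> M ` A" using imageI[OF A(3), of "lyap \<beta> M"] by simp
    ultimately have "\<epsilon> \<in> lyap \<beta> M ` A"
      using connectedD_interval[OF conn, of 0 "lyap \<beta> M q" \<epsilon>] A(4) assms(3) by auto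
    with A(2) show False by (auto simp: level_def)
  qed
  with A show "q \<in> ?S" by blast
next
  fix q assume q: "q \<in> ?S"
  have "connected (ray \<beta> M q ` {0..1})"
    by (intro connected_continuous_image continuous_on_ray) simp
  moreover have "ray \<beta> M q ` {0..1} \<subseteq> Sig \<beta> (- \<beta> * M) - level \<beta> M \<epsilon>"
  proof
    fix v assume "v \<in> ray \<beta> M q ` {0..1}"
    then obtain s where s: "0 \<le> s" "s \<le> 1" "v = ray \<beta> M q s" by auto
    have "0 \<le> radius2 \<beta> M q" unfolding radius2_eq[OF assms(2)] by simp
    then have "lyap \<beta> M (ray \<beta> M q s) \<le> lyap \<beta> M (ray \<beta> M q 1)"
      unfolding lyap_ray using s by (intro add_mono mult_right_mono power_mono) auto
    then have "lyap \<beta> M v < \<epsilon>" using q ray_1[OF assms(1)] s by simp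
    then show "v \<in> Sig \<beta> (- \<beta> * M) - level \<beta> M \<epsilon>"
      using ray_in_Sig[OF assms(1)] s by (simp add: level_def)
  qed
  moreover have "vector [0, 0, M] \<in> ray \<beta> M q ` {0..1}"
    using image_eqI[of _ "ray \<beta> M q" 0 "{0..1}"] by (simp add: ray_0)
  moreover have "q \<in> ray \<beta> M q ` {0..1}"
    by (rule image_eqI[of _ _ 1]) (use q ray_1[OF assms(1), of q M] in auto)
  ultimately show "q \<in> ?C" unfolding connected_component_def by blast
qed

lemma sublevel_eq_Union_levels:
  assumes "\<beta> \<noteq> 0" "\<bar>M\<bar> < \<bar>\<beta>\<bar>" "0 < \<epsilon>0"
  shows "insert (vector [0, 0, M]) (\<Union>\<epsilon>\<in>{0<..<\<epsilon>0}. level \<beta> M \<epsilon>) =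
    {p \<in> Sig \<beta> (- \<beta> * M). lyap \<beta> M p < \<epsilon>0}"
proof -
  have "p = vector [0, 0, M]" if "\<not> 0 < lyap \<beta> M p" for p
    using that lyap_nonneg[OF assms(2), of p] lyap_eq_0_iff[OF assms(2), of p] by simp
  then show ?thesis
    using equilibrium_in_Sig[OF assms(1), of M] assms(3) by (auto simp: level_def)
qed

lemma level_subset_ball:
  assumes "\<bar>M\<bar> < \<bar>\<beta>\<bar>" "0 < e"
  shows "\<forall>\<^sub>F \<epsilon> in at_right 0. level \<beta> M \<epsilon> \<subseteq> ball (vector [0, 0, M]) e"
proof -
  have "0 < (1 - \<bar>M / \<beta>\<bar>) * e\<^sup>2" using abs_ratio_less_1[OF assms(1)] assms(2) by simp
  then have "\<forall>\<^sub>F \<epsilon> in at_right 0. \<epsilon> < (1 - \<bar>M / \<beta>\<bar>) * e\<^sup>2"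
    by (rule order_tendstoD(2)[OF tendsto_ident_at])
  then show ?thesis
    by eventually_elim (use dist_less_if_lyap_less[OF assms] in \<open>auto simp: level_def dist_commute\<close>)
qed

theorem theorem7p3:
  fixes \<beta> M :: real
  assumes "\<beta> \<noteq> 0"
  shows "charpoly_on (tangent_space (Sig \<beta> (- \<beta> * M)) (vector [0, 0, M]))
           (linearization (Xb \<beta>) (vector [0, 0, M])) = [:\<beta>\<^sup>2 - M\<^sup>2, 0, 1:]
    \<and> (\<bar>\<beta>\<bar> < \<bar>M\<bar> \<longrightarrow> unstable_on (Xb \<beta>) (Sig \<beta> (- \<beta> * M)) (vector [0, 0, M]))
    \<and> (\<bar>\<beta>\<bar> > \<bar>M\<bar> \<longrightarrow> lyapunov_stable_on (Xb \<beta>) (Sig \<beta> (- \<beta> * M)) (vector [0, 0, M]))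
    \<and> (\<bar>\<beta>\<bar> > \<bar>M\<bar> \<longrightarrow>
        (\<exists>\<epsilon>0 > 0. \<exists>(\<gamma> :: real \<Rightarrow> (real^3) set) (T :: real \<Rightarrow> real).
           (\<forall>\<epsilon>\<in>{0<..\<epsilon>0}. periodic_orbit (Xb \<beta>) (\<gamma> \<epsilon>) (T \<epsilon>)
                              \<and> \<gamma> \<epsilon> \<subseteq> Sig \<beta> (- \<beta> * M)) \<and>
           inj_on \<gamma> {0<..\<epsilon>0} \<and>
           (\<forall>e>0. \<forall>\<^sub>F \<epsilon> in at_right 0. \<gamma> \<epsilon> \<subseteq> ball (vector [0, 0, M]) e) \<and>
           (T \<longlongrightarrow> 2 * pi / sqrt (\<beta>\<^sup>2 - M\<^sup>2)) (at_right 0) \<and>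
           insert (vector [0, 0, M]) (\<Union>\<epsilon>\<in>{0<..<\<epsilon>0}. \<gamma> \<epsilon>) =
             connected_component_set (Sig \<beta> (- \<beta> * M) - \<gamma> \<epsilon>0) (vector [0, 0, M])))"
proof (intro conjI impI)
  have "linearization (Xb \<beta>) (vector [0, 0, M]) = Xb_lin \<beta> M"
    by (rule ext) (rule linearization_Xb)
  then show "charpoly_on (tangent_space (Sig \<beta> (- \<beta> * M)) (vector [0, 0, M]))
      (linearization (Xb \<beta>) (vector [0, 0, M])) = [:\<beta>\<^sup>2 - M\<^sup>2, 0, 1:]"
    unfolding tangent_space_Sig[OF assms] by (simp only: charpoly_Xb_lin)
next
  assume "\<bar>\<beta>\<bar> < \<bar>M\<bar>"
  with assms show "unstable_on (Xb \<beta>) (Sig \<beta> (- \<beta> * M)) (vector [0, 0, M])"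
    by (rule equilibrium_unstable)
next
  assume "\<bar>\<beta>\<bar> > \<bar>M\<bar>"
  with assms show "lyapunov_stable_on (Xb \<beta>) (Sig \<beta> (- \<beta> * M)) (vector [0, 0, M])"
    by (rule equilibrium_stable)
next
  assume less: "\<bar>\<beta>\<bar> > \<bar>M\<bar>"
  define T0 where "T0 = 2 * pi / sqrt (\<beta>\<^sup>2 - M\<^sup>2)"
  define C where "C = 1 / (4 * \<beta>\<^sup>2 * (1 - \<bar>M / \<beta>\<bar>)\<^sup>2)"
  have C: "0 \<le> C" by (simp add: C_def)
  have "\<forall>\<epsilon>\<in>{0<..}. \<exists>T. periodic_orbit (Xb \<beta>) (level \<beta> M \<epsilon>) T \<and> T \<le> T0 \<and> T0 \<le> (1 + C * \<epsilon>) * T"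
    using level_periodic_orbit[OF assms less] unfolding T0_def C_def by auto
  then obtain T where T: "\<And>\<epsilon>. 0 < \<epsilon> \<Longrightarrow> periodic_orbit (Xb \<beta>) (level \<beta> M \<epsilon>) (T \<epsilon>)"
    "\<And>\<epsilon>. 0 < \<epsilon> \<Longrightarrow> T \<epsilon> \<le> T0" "\<And>\<epsilon>. 0 < \<epsilon> \<Longrightarrow> T0 \<le> (1 + C * \<epsilon>) * T \<epsilon>"
    using bchoice[of "{0<..}"] by (metis greaterThan_iff)
  have pos: "\<forall>\<^sub>F \<epsilon> in at_right 0. (0::real) < \<epsilon>" by (rule eventually_at_right_less)
  have "(T \<longlongrightarrow> T0) (at_right 0)"
  \<comment> \<open>The two-sided comparison reads
    \<open>T0 / (1 + C * \<epsilon>) \<le> T \<epsilon> \<le> T0\<close>.\<close>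
  proof (rule tendsto_sandwich)
    show "((\<lambda>\<epsilon>. T0 / (1 + C * \<epsilon>)) \<longlongrightarrow> T0) (at_right 0)"
      by (auto intro!: tendsto_eq_intros)
    show "\<forall>\<^sub>F \<epsilon> in at_right 0. T0 / (1 + C * \<epsilon>) \<le> T \<epsilon>"
      using pos
    proof eventually_elim
      case (elim \<epsilon>)
      then have "0 < 1 + C * \<epsilon>" using C by (simp add: add_pos_nonneg)
      then show ?case using T(3)[OF elim] by (simp add: field_simps)
    qed
    show "\<forall>\<^sub>F \<epsilon> in at_right 0. T \<epsilon> \<le> T0" using pos by eventually_elim (rule T(2))
  qed (rule tendsto_const)
  \<comment> \<open>Every positive level is a periodic orbit, so the bound 1 for the parameter is an
    arbitrary choice.\<close>
  moreover have "inj_on (level \<beta> M) {0<..1}"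
  proof (rule inj_onI)
    fix \<epsilon> \<delta> assume "\<epsilon> \<in> {0<..1::real}" "level \<beta> M \<epsilon> = level \<beta> M \<delta>"
    moreover from this obtain p where "p \<in> level \<beta> M \<epsilon>" using level_nonempty[OF assms less] by fastforce
    ultimately show "\<epsilon> = \<delta>" by (auto simp: level_def)
  qed
  moreover have "insert (vector [0, 0, M]) (\<Union>\<epsilon>\<in>{0<..<1}. level \<beta> M \<epsilon>) =
      connected_component_set (Sig \<beta> (- \<beta> * M) - level \<beta> M 1) (vector [0, 0, M])"
    using connected_component_sublevel[OF assms less] sublevel_eq_Union_levels[OF assms less] by simp
  moreover have "level \<beta> M \<epsilon> \<subseteq> Sig \<beta> (- \<beta> * M)" for \<epsilon> by (auto simp: level_def)
  ultimately show "\<exists>\<epsilon>0 > 0. \<exists>(\<gamma> :: real \<Rightarrow> (real^3) set) (T :: real \<Rightarrow> real).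
           (\<forall>\<epsilon>\<in>{0<..\<epsilon>0}. periodic_orbit (Xb \<beta>) (\<gamma> \<epsilon>) (T \<epsilon>)
                              \<and> \<gamma> \<epsilon> \<subseteq> Sig \<beta> (- \<beta> * M)) \<and>
           inj_on \<gamma> {0<..\<epsilon>0} \<and>
           (\<forall>e>0. \<forall>\<^sub>F \<epsilon> in at_right 0. \<gamma> \<epsilon> \<subseteq> ball (vector [0, 0, M]) e) \<and>
           (T \<longlongrightarrow> 2 * pi / sqrt (\<beta>\<^sup>2 - M\<^sup>2)) (at_right 0) \<and>
           insert (vector [0, 0, M]) (\<Union>\<epsilon>\<in>{0<..<\<epsilon>0}. \<gamma> \<epsilon>) =
             connected_component_set (Sig \<beta> (- \<beta> * M) - \<gamma> \<epsilon>0) (vector [0, 0, M])"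
    using T(1) level_subset_ball[OF less]
    by (intro exI[of _ 1] exI[of _ "level \<beta> M"] exI[of _ T] conjI) (auto simp: T0_def)
qed

end
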